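(* Let $\phi:R_{a,b}\to\Omega_{a,b}$ and $\psi:R_{a',b'}\to\Omega_{a',b'}$ be biholomorphic maps onto domains of the upper half-plane $\mathbb{H}$ that extend homeomorphically to the boundaries, and let $\varphi:[0,b]\to[0,b']$ with $\varphi(0)=0$, $\varphi(b)=b'$ and $\dot\varphi\ge\frac{a'}{a}$. Suppose that $(S,X,\Theta):\,]0,a[\times]0,b[\times\mathbb{R}\to\,]0,a'[\times]0,b'[\times\mathbb{R}$ is a contact transform such that $g_\varphi\circ\Pi\circ\Psi_\phi=\Pi\circ\Psi_\psi\circ(S,X,\Theta)$. Then $S(s,x,\theta)=\frac{a'}{a}s$ and $X(s,x,\theta)=\varphi(x)$ for every $(s,x,\theta)\in\,]0,a[\times]0,b[\times\mathbb{R}$. Moreover, $\varphi$, $\psi$ and $\phi$ satisfy, for every $(s,x)\in\,]0,a[\times]0,b[$, $$\frac{a'}{a}\,\dot\varphi(x)\,\frac{\left|\psi'\left(\frac{a'}{a}s,\varphi(x)\right)\right|^2\left(\Im(\phi(s,x))\right)^2}{|\phi'(s,x)|^2\left(\Im\left(\psi\left(\frac{a'}{a}s,\varphi(x)\right)\right)\right)^2}=1.\qquad(\ast)$$ Conversely, if $(\ast)$ is satisfied for every $(s,x)$, then the map $(S,X,\Theta)(s,x,\theta)=\left(\frac{a'}{a}s,\varphi(x),\theta+h(s,x)\right)$ with $$2h_x(s,x)=\frac{\Im\left(\psi_s\left(\frac{a'}{a}s,\varphi(x)\right)\right)}{\Im\left(\psi\left(\frac{a'}{a}s,\varphi(x)\right)\right)}\,\dot\varphi(x)-\frac{\Im(\phi_s(s,x))}{\Im(\phi(s,x))},$$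 $$2h_s(s,x)=\frac{\Re(\phi_s(s,x))}{\Im(\phi(s,x))}-\frac{a'}{a}\,\frac{\Re\left(\psi_s\left(\frac{a'}{a}s,\varphi(x)\right)\right)}{\Im\left(\psi\left(\frac{a'}{a}s,\varphi(x)\right)\right)}$$ is a contact transform satisfying $g_\varphi\circ\Pi\circ\Psi_\phi=\Pi\circ\Psi_\psi\circ(S,X,\Theta)$.
   Context: The Heisenberg group is $\mathbf{H}=\mathbb{C}\times\mathbb{R}$ with contact form $\omega=dt-i\overline z\,dz+iz\,d\overline z$; a map $f$ between domains of $\mathbf{H}$ is contact if $f^\ast\omega=\lambda\omega$ with $\lambda$ a nowhere vanishing real function. $\Pi(z,t)=t+i|z|^2$ maps $\mathbf{H}\setminus(\{0\}\times\mathbb{R})$ to $\mathbb{H}$. $R_{a,b}=\{w\in\mathbb{H}\mid0<\Re w<a,\ 0<\Im w<b\}$ with $a,b,a',b'>0$. The rectangles are identified with $]0,a[\times]0,b[$ and $]0,a'[\times]0,b'[$, so $\phi(s,x)=\phi(s+ix)$, $\psi(s,x)=\psi(s+ix)$; $\phi',\psi'$ are complex derivatives; indices $s,x$ denote partial derivatives with respect to the first and second variable, and $\dot\varphi$ is the derivative of $\varphi$. Put $f_\varphi(x+iy)=\frac{a'}{a}x+i\varphi(y)$ and $g_\varphi=\psi\circ f_\varphi\circ\phi^{-1}:\Omega_{a,b}\to\Omega_{a',b'}$. Let $\widetilde\Omega_{a,b}=\Pi^{-1}(\Omega_{a,b})$ and $\widetilde\Omega_{a',b'}=\Pi^{-1}(\Omega_{a',b'})$.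 Define $\Psi_\phi:\,]0,a[\times]0,b[\times\mathbb{R}\to\widetilde\Omega_{a,b}$ by $\Psi_\phi(s,x,\theta)=(\sqrt{\Im(\phi(s,x))}\,e^{i\theta},\Re(\phi(s,x)))$, and $\Psi_\psi:\,]0,a'[\times]0,b'[\times\mathbb{R}\to\widetilde\Omega_{a',b'}$ in the same way from $\psi$. $(S,X,\Theta)$ is a contact transform if it defines, through $\Psi_\phi$ and $\Psi_\psi$, a contact homeomorphism from $\widetilde\Omega_{a,b}$ to $\widetilde\Omega_{a',b'}$ (in particular $S$, $X$ and $\Theta$ mod $2\pi$ are $2\pi$-periodic in $\theta$); the contact condition is equivalent to the existence of a nowhere vanishing function $\lambda$ with $$\Re(\psi_s(S,X))\,dS-\Im(\psi_s(S,X))\,dX+2\Im(\psi(S,X))\,d\Theta=\lambda\left(\Re(\phi_s)\,ds-\Im(\phi_s)\,dx+2\Im(\phi)\,d\theta\right).$$ Standing assumption: all quasiconformal and contact maps considered (in $\mathbf{H}$ and in the plane, including $g_\varphi$) are $C^2$ and orientation preserving. *)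

theory Defs
  imports "HOL-Complex_Analysis.Complex_Analysis"
begin

definition C2_on :: "('v::real_normed_vector \<Rightarrow> 'w::real_normed_vector) \<Rightarrow> 'v set \<Rightarrow> bool" where
  "C2_on f U \<longleftrightarrow> (\<exists>(f' :: 'v \<Rightarrow> 'v \<Rightarrow>\<^sub>L 'w) (f'' :: 'v \<Rightarrow> 'v \<Rightarrow>\<^sub>L ('v \<Rightarrow>\<^sub>L 'w)).
     (\<forall>p\<in>U. (f has_derivative blinfun_apply (f' p)) (at p)) \<and>
     (\<forall>p\<in>U. (f' has_derivative blinfun_apply (f'' p)) (at p)) \<and>
     continuous_on U f'')"

text \<open>
  Here \<open>c\<close> is a linear isomorphism onto coordinate space; the Jacobian determinant does not
  depend on its choice.
\<close>

definition orientation_preserving_on ::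
    "('v::real_normed_vector \<Rightarrow> real^'n) \<Rightarrow> ('v \<Rightarrow> 'v) \<Rightarrow> 'v set \<Rightarrow> bool" where
  "orientation_preserving_on c f U \<longleftrightarrow>
     (\<forall>p\<in>U. 0 < det (matrix (c \<circ> frechet_derivative f (at p) \<circ> inv c)))"

definition plane_coord :: "complex \<Rightarrow> real^2" where
  "plane_coord w = vector [Re w, Im w]"

definition biholomorphic_onto :: "(complex \<Rightarrow> complex) \<Rightarrow> complex set \<Rightarrow> complex set \<Rightarrow> bool" where
  "biholomorphic_onto f A B \<longleftrightarrow>
     bij_betw f A B \<and> f holomorphic_on A \<and> inv_into A f holomorphic_on B"

definition extends_homeomorphically ::
    "(complex \<Rightarrow> complex) \<Rightarrow> complex set \<Rightarrow> complex set \<Rightarrow> bool" where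
  "extends_homeomorphically f A B \<longleftrightarrow>
     (\<exists>F G. homeomorphism (closure A) (closure B) F G \<and> (\<forall>w\<in>A. F w = f w))"

definition upper_half_plane :: "complex set" where
  "upper_half_plane = {w. 0 < Im w}"

definition rect :: "real \<Rightarrow> real \<Rightarrow> complex set" where
  "rect a b = {w. 0 < Re w \<and> Re w < a \<and> 0 < Im w \<and> Im w < b}"

definition cyl :: "real \<Rightarrow> real \<Rightarrow> (real \<times> real \<times> real) set" where
  "cyl a b = {0<..<a} \<times> {0<..<b} \<times> UNIV"

text \<open>The partial derivative $F_s$ of $F(s,x) = F(s+ix)$.\<close>

definition partial_s :: "(complex \<Rightarrow> complex) \<Rightarrow> real \<Rightarrow> real \<Rightarrow> complex" where
  "partial_s F s x = vector_derivative (\<lambda>\<sigma>. F (Complex \<sigma> x)) (at s)"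


subsection \<open>The Heisenberg group\<close>

type_synonym heis = "complex \<times> real"

definition heis_coord :: "heis \<Rightarrow> real^3" where
  "heis_coord p = vector [Re (fst p), Im (fst p), snd p]"

text \<open>
  \<open>contact_form p v\<close> is $\omega = dt - i \overline z\,dz + i z\,d\overline z$ at the point \<open>p\<close>
  applied to the tangent vector \<open>v\<close>. It is complex-typed, but its values are real.
\<close>

definition contact_form :: "heis \<Rightarrow> heis \<Rightarrow> complex" where
  "contact_form p v =
     complex_of_real (snd v) - \<i> * cnj (fst p) * fst v + \<i> * fst p * cnj (fst v)"

definition contact_on :: "(heis \<Rightarrow> heis) \<Rightarrow> heis set \<Rightarrow> bool" where
  "contact_on f U \<longleftrightarrow>
     (\<exists>l :: heis \<Rightarrow> real. \<forall>p\<in>U. l p \<noteq> 0 \<and>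
        (\<forall>v. contact_form (f p) (frechet_derivative f (at p) v)
              = complex_of_real (l p) * contact_form p v))"

definition Pi_map :: "heis \<Rightarrow> complex" where
  "Pi_map p = Complex (snd p) ((cmod (fst p))\<^sup>2)"

definition Psi :: "(complex \<Rightarrow> complex) \<Rightarrow> real \<times> real \<times> real \<Rightarrow> heis" where
  "Psi F = (\<lambda>(s, x, \<theta>).
     (complex_of_real (sqrt (Im (F (Complex s x)))) * cis \<theta>, Re (F (Complex s x))))"

text \<open>
  The map \<open>T\<close> = $(S,X,\Theta)$ is a contact transform if it covers, through \<open>Psi phi\<close> and
  \<open>Psi psi\<close>, a \<open>C\<^sup>2\<close> orientation preserving contact homeomorphism \<open>f\<close> of the preimages of
  \<open>\<Omega>\<close> and \<open>\<Omega>'\<close> under \<open>Pi_map\<close>. Since \<open>Psi psi\<close> only sees $\Theta$ modulo $2\pi$, the regularity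
  of the lift \<open>T\<close> itself, which is needed for $d\Theta$ to make sense, is a separate clause.
\<close>

definition contact_transform ::
    "real \<Rightarrow> real \<Rightarrow> real \<Rightarrow> real \<Rightarrow> (complex \<Rightarrow> complex) \<Rightarrow> (complex \<Rightarrow> complex) \<Rightarrow>
     complex set \<Rightarrow> complex set \<Rightarrow> (real \<times> real \<times> real \<Rightarrow> real \<times> real \<times> real) \<Rightarrow> bool" where
  "contact_transform a b a' b' phi psi \<Omega> \<Omega>' T \<longleftrightarrow>
     T ` cyl a b \<subseteq> cyl a' b' \<and> C2_on T (cyl a b) \<and>
     (\<exists>f g. homeomorphism (Pi_map -` \<Omega>) (Pi_map -` \<Omega>') f g \<and>
        C2_on f (Pi_map -` \<Omega>) \<and>
        orientation_preserving_on heis_coord f (Pi_map -` \<Omega>) \<and>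
        contact_on f (Pi_map -` \<Omega>) \<and>
        (\<forall>p\<in>cyl a b. f (Psi phi p) = Psi psi (T p)))"


subsection \<open>The planar stretch map\<close>

definition f_map :: "real \<Rightarrow> real \<Rightarrow> (real \<Rightarrow> real) \<Rightarrow> complex \<Rightarrow> complex" where
  "f_map a a' \<phi> w = Complex (a' / a * Re w) (\<phi> (Im w))"

definition g_map ::
    "real \<Rightarrow> real \<Rightarrow> real \<Rightarrow> (complex \<Rightarrow> complex) \<Rightarrow> (complex \<Rightarrow> complex) \<Rightarrow> (real \<Rightarrow> real) \<Rightarrow>
     complex \<Rightarrow> complex" where
  "g_map a b a' phi psi \<phi> = psi \<circ> f_map a a' \<phi> \<circ> inv_into (rect a b) phi"

definition star_condition ::
    "real \<Rightarrow> real \<Rightarrow> real \<Rightarrow> (complex \<Rightarrow> complex) \<Rightarrow> (complex \<Rightarrow> complex) \<Rightarrow> (real \<Rightarrow> real) \<Rightarrow>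
     bool" where
  "star_condition a b a' phi psi \<phi> \<longleftrightarrow>
     (\<forall>s\<in>{0<..<a}. \<forall>x\<in>{0<..<b}.
        a' / a * deriv \<phi> x *
        (((cmod (deriv psi (Complex (a' / a * s) (\<phi> x))))\<^sup>2 * (Im (phi (Complex s x)))\<^sup>2) /
         ((cmod (deriv phi (Complex s x)))\<^sup>2 * (Im (psi (Complex (a' / a * s) (\<phi> x))))\<^sup>2)) = 1)"

definition h_equations ::
    "real \<Rightarrow> real \<Rightarrow> real \<Rightarrow> (complex \<Rightarrow> complex) \<Rightarrow> (complex \<Rightarrow> complex) \<Rightarrow> (real \<Rightarrow> real) \<Rightarrow>
     (real \<Rightarrow> real \<Rightarrow> real) \<Rightarrow> bool" where
  "h_equations a b a' phi psi \<phi> h \<longleftrightarrow>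
     (\<forall>s\<in>{0<..<a}. \<forall>x\<in>{0<..<b}. \<exists>hs hx.
        ((\<lambda>\<xi>. h s \<xi>) has_real_derivative hx) (at x) \<and>
        ((\<lambda>\<sigma>. h \<sigma> x) has_real_derivative hs) (at s) \<and>
        2 * hx = Im (partial_s psi (a' / a * s) (\<phi> x)) / Im (psi (Complex (a' / a * s) (\<phi> x)))
                   * deriv \<phi> x
                 - Im (partial_s phi s x) / Im (phi (Complex s x)) \<and>
        2 * hs = Re (partial_s phi s x) / Im (phi (Complex s x))
                 - a' / a * (Re (partial_s psi (a' / a * s) (\<phi> x))
                              / Im (psi (Complex (a' / a * s) (\<phi> x)))))"

end

theory Submission
  imports Defs
begin

text \<open>
  In the coordinates \<open>Psi phi\<close> the contact form becomes \<open>2 * Im phi\<close> times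
  \<open>d\<theta> + U\<^sub>0 ds + V\<^sub>0 dx\<close>, and the pull back of the contact form of the target under a lift of \<open>f_map\<close>
  is \<open>2 * Im psi\<close> times \<open>d\<Theta> + U\<^sub>1 ds + V\<^sub>1 dx\<close>. The curls of the two planar forms are \<open>\<kappa>\<^sub>0\<close> and \<open>\<kappa>\<^sub>1\<close>,
  both positive, and condition \<open>(*)\<close> says that they agree. If the lift is contact, then
  \<open>d\<Theta> = \<Theta>\<^sub>\<theta> * (d\<theta> + U\<^sub>0 ds + V\<^sub>0 dx) - (U\<^sub>1 ds + V\<^sub>1 dx)\<close>, and symmetry of the second derivatives
  of \<open>\<Theta>\<close> gives \<open>\<Theta>\<^sub>\<theta> * \<kappa>\<^sub>0 = \<kappa>\<^sub>1\<close>. So \<open>\<Theta>\<^sub>\<theta>\<close> is positive and constant along each circle, and since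
  the lift is injective on circles it equals 1. Conversely, \<open>(*)\<close> makes the difference of the planar forms
  closed, hence exact on the rectangle, and a primitive \<open>h\<close> gives the contact lift.
\<close>

subsection \<open>Second derivatives and closed forms\<close>

text \<open>The normalised contact form is a connection on the circle bundle given by
  \<open>Pi_map\<close> over the half-plane. On |z|^2 = Im w it reads d\<theta> + d(Re w) / (2 Im
  w), and its curvature is half the hyperbolic area. So \<open>\<kappa>\<^sub>0\<close> and
  \<open>\<kappa>\<^sub>1\<close> are half the hyperbolic area density, pulled back by phi and by
  psi composed with the stretch, and the star condition says that g preserves hyperbolic area.
  \<open>\<kappa>\<^sub>1\<close> is positive because the lower bound on the derivative of \<phi>
  gives the stretch a positive Jacobian; this excludes the slope -1 along the circles. Two obstacles
  shape the work. The function \<phi> is only assumed differentiable, while differentiating the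
  pulled back form involves its second derivative; the missing regularity is recovered from that of
  g. And the cylinder merely covers the Heisenberg domains: the map of the converse is therefore
  written in the coordinates (z, t), without a choice of angle, whereas its contact and orientation
  properties are tested on images of tangent vectors of the cylinder.\<close>

lemma mixed_difference_mvt:
  fixes f :: "'v::real_normed_vector \<Rightarrow> real"
  assumes f': "\<And>q. q \<in> ball p r \<Longrightarrow> (f has_derivative blinfun_apply (f' q)) (at q)"
    and f'': "\<And>q. q \<in> ball p r \<Longrightarrow> (f' has_derivative blinfun_apply (f'' q)) (at q)"
    and h: "0 < h" "h * (norm u + norm v) < r"
  obtains q where "q \<in> ball p r"
    "f (p + h *\<^sub>R u + h *\<^sub>R v) - f (p + h *\<^sub>R u) - f (p + h *\<^sub>R v) + f p = h * h * f'' q v u"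
proof -
  have inball: "p + t *\<^sub>R u + s *\<^sub>R v \<in> ball p r" if "0 \<le> t" "t \<le> h" "0 \<le> s" "s \<le> h" for t s
  proof -
    have "norm (t *\<^sub>R u + s *\<^sub>R v) \<le> t * norm u + s * norm v"
      using norm_triangle_ineq[of "t *\<^sub>R u" "s *\<^sub>R v"] that by simp
    also have "\<dots> \<le> h * norm u + h * norm v"
      using that by (intro add_mono mult_right_mono) auto
    also have "\<dots> < r" using h by (simp add: algebra_simps)
    finally show ?thesis
      by (simp add: dist_norm algebra_simps norm_minus_commute)
  qed
  define g where "g t = f (p + t *\<^sub>R u + h *\<^sub>R v) - f (p + t *\<^sub>R u)" for t
  have dg: "(g has_real_derivative f' (p + t *\<^sub>R u + h *\<^sub>R v) u - f' (p + t *\<^sub>R u) u) (at t)"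
    if t: "0 \<le> t" "t \<le> h" for t
  proof -
    have 1: "(f has_derivative blinfun_apply (f' (p + t *\<^sub>R u + h *\<^sub>R v))) (at (p + t *\<^sub>R u + h *\<^sub>R v))"
      and 2: "(f has_derivative blinfun_apply (f' (p + t *\<^sub>R u))) (at (p + t *\<^sub>R u))"
      using f'[OF inball[OF t, of h]] f'[OF inball[OF t, of 0]] h(1) by simp_all
    show ?thesis unfolding g_def has_field_derivative_def
      by (rule derivative_eq_intros refl
          has_derivative_compose[where g = f and f = "\<lambda>t. p + t *\<^sub>R u + h *\<^sub>R v", OF _ 1]
          has_derivative_compose[where g = f and f = "\<lambda>t. p + t *\<^sub>R u", OF _ 2] | simp)+
        (auto simp: fun_eq_iff blinfun.bilinear_simps algebra_simps)
  qed
  obtain t where t: "0 < t" "t < h" "g h - g 0 = (h - 0) * (f' (p + t *\<^sub>R u + h *\<^sub>R v) u - f' (p + t *\<^sub>R u) u)"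
    using MVT2[OF h(1) dg] by auto
  define k where "k s = f' (p + t *\<^sub>R u + s *\<^sub>R v) u" for s
  have dk: "(k has_real_derivative f'' (p + t *\<^sub>R u + s *\<^sub>R v) v u) (at s)" if s: "0 \<le> s" "s \<le> h" for s
  proof -
    have 1: "(f' has_derivative blinfun_apply (f'' (p + t *\<^sub>R u + s *\<^sub>R v))) (at (p + t *\<^sub>R u + s *\<^sub>R v))"
      using f''[OF inball[of t s]] t s by simp
    show ?thesis unfolding k_def has_field_derivative_def
      by (rule derivative_eq_intros refl
          has_derivative_compose[where g = f' and f = "\<lambda>s. p + t *\<^sub>R u + s *\<^sub>R v", OF _ 1] | simp)+
        (auto simp: fun_eq_iff blinfun.bilinear_simps algebra_simps)
  qed
  obtain s where s: "0 < s" "s < h" "k h - k 0 = (h - 0) * f'' (p + t *\<^sub>R u + s *\<^sub>R v) v u"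
    using MVT2[OF h(1) dk] by auto
  show ?thesis
  proof (rule that[of "p + t *\<^sub>R u + s *\<^sub>R v"])
    show "p + t *\<^sub>R u + s *\<^sub>R v \<in> ball p r" using inball t s by auto
    have "f (p + h *\<^sub>R u + h *\<^sub>R v) - f (p + h *\<^sub>R u) - f (p + h *\<^sub>R v) + f p = g h - g 0"
      by (simp add: g_def)
    also have "\<dots> = h * (k h - k 0)" using t by (simp add: k_def)
    finally show "f (p + h *\<^sub>R u + h *\<^sub>R v) - f (p + h *\<^sub>R u) - f (p + h *\<^sub>R v) + f p
        = h * h * f'' (p + t *\<^sub>R u + s *\<^sub>R v) v u" using s by simp
  qed
qed

text \<open>The double difference is symmetric in u and v, and two applications of the mean value
  theorem in either order express it by the second derivative at points q and q' near p. Continuity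
  of the second derivative at p closes the gap between q, q' and p.\<close>

lemma second_derivative_symmetric:
  fixes f :: "'v::real_normed_vector \<Rightarrow> real"
  assumes U: "open U" "p \<in> U"
    and f': "\<And>q. q \<in> U \<Longrightarrow> (f has_derivative blinfun_apply (f' q)) (at q)"
    and f'': "\<And>q. q \<in> U \<Longrightarrow> (f' has_derivative blinfun_apply (f'' q)) (at q)"
    and cont: "continuous_on U f''"
  shows "f'' p u v = f'' p v u"
proof (rule ccontr)
  assume ne: "f'' p u v \<noteq> f'' p v u"
  define e where "e = \<bar>f'' p u v - f'' p v u\<bar> / 2"
  have e: "0 < e" using ne by (simp add: e_def)
  have c: "continuous_on U (\<lambda>q. f'' q x y)" for x y
    by (intro continuous_intros cont)
  have tend: "((\<lambda>q. f'' q x y) \<longlongrightarrow> f'' p x y) (nhds p)" for x y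
    using c[of x y] U tendsto_at_iff_tendsto_nhds[of "\<lambda>q. f'' q x y" p]
    by (simp add: continuous_on_eq_continuous_at isCont_def)
  have ev: "\<forall>\<^sub>F q in nhds p. q \<in> U \<and> dist (f'' q u v) (f'' p u v) < e \<and> dist (f'' q v u) (f'' p v u) < e"
    using tend U e by (intro eventually_conj tendstoD eventually_nhds_in_open)
  then obtain r where r: "0 < r" "\<And>q. q \<in> ball p r \<Longrightarrow> q \<in> U"
      "\<And>q. q \<in> ball p r \<Longrightarrow> dist (f'' q u v) (f'' p u v) < e"
      "\<And>q. q \<in> ball p r \<Longrightarrow> dist (f'' q v u) (f'' p v u) < e"
    unfolding eventually_nhds_metric by (auto simp: dist_commute)
  \<comment> \<open>The summand 1 keeps the denominator positive when u and v both vanish.\<close>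
  define h where "h = r / (norm u + norm v + 1)"
  have h: "0 < h" "h * (norm u + norm v) < r" "h * (norm v + norm u) < r"
    using r(1) by (auto simp: h_def divide_simps add_pos_nonneg add_nonneg_pos algebra_simps)
  obtain q where q: "q \<in> ball p r"
    "f (p + h *\<^sub>R u + h *\<^sub>R v) - f (p + h *\<^sub>R u) - f (p + h *\<^sub>R v) + f p = h * h * f'' q v u"
    using mixed_difference_mvt[OF f'[OF r(2)] f''[OF r(2)] h(1,2)] by blast
  obtain q' where q': "q' \<in> ball p r"
    "f (p + h *\<^sub>R v + h *\<^sub>R u) - f (p + h *\<^sub>R v) - f (p + h *\<^sub>R u) + f p = h * h * f'' q' u v"
    using mixed_difference_mvt[OF f'[OF r(2)] f''[OF r(2)] h(1,3)] by blast
  have "h * h * f'' q v u = h * h * f'' q' u v"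
    using q(2) q'(2) by (simp add: algebra_simps)
  then have "f'' q v u = f'' q' u v" using h by simp
  with r(3)[OF q'(1)] r(4)[OF q(1)] have "\<bar>f'' p u v - f'' p v u\<bar> < 2 * e"
    unfolding dist_real_def by linarith
  then show False by (simp add: e_def)
qed

text \<open>Star-shaped primitive from the centre \<open>c\<close>: symmetry of \<open>G'\<close> turns the differentiated
  integrand into \<open>d/dt (t *\<^sub>R G (c + t *\<^sub>R (p - c)))\<close>.\<close>

lemma Poincare_convex:
  fixes G :: "'v::euclidean_space \<Rightarrow> 'v \<Rightarrow>\<^sub>L real"
  assumes U: "open U" "convex U"
    and G: "\<And>p. p \<in> U \<Longrightarrow> (G has_derivative blinfun_apply (G' p)) (at p)"
    and cont: "continuous_on U G'"
    and sym: "\<And>p u v. p \<in> U \<Longrightarrow> G' p u v = G' p v u"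
  obtains h where "\<And>p. p \<in> U \<Longrightarrow> (h has_derivative blinfun_apply (G p)) (at p)"
proof (cases "U = {}")
  case True
  then show ?thesis using that by auto
next
  case False
  then obtain c where c: "c \<in> U" by auto
  define l where "l p t = c + t *\<^sub>R (p - c)" for p t
  have lU: "l p t \<in> U" if "p \<in> U" "t \<in> cbox 0 (1::real)" for p t
  proof -
    have "l p t = (1 - t) *\<^sub>R c + t *\<^sub>R p" by (simp add: l_def algebra_simps)
    then show ?thesis using convexD_alt[OF U(2) c that(1), of t] that(2) by simp
  qed
  define h where "h p = integral (cbox 0 1) (\<lambda>t. G (l p t) (p - c))" for p
  define H where "H p t = G (l p t) + t *\<^sub>R G' (l p t) (p - c)" for p t
  have contG: "continuous_on U G"
    by (intro continuous_at_imp_continuous_on ballI has_derivative_continuous[OF G])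
  have contl: "continuous_on (U \<times> cbox 0 1) (\<lambda>(p, t). l p t)"
    unfolding l_def split_beta by (intro continuous_intros)
  have contl2: "continuous_on (cbox 0 1) (l p)" for p
    unfolding l_def by (intro continuous_intros)
  have "(h has_derivative blinfun_apply (G p)) (at p)" if p: "p \<in> U" for p
  proof -
    have "((\<lambda>p. integral (cbox 0 1) (\<lambda>t. G (l p t) (p - c))) has_derivative integral (cbox 0 1) (H p)) (at p within U)"
    proof (rule leibniz_rule[OF _ _ _ p U(2)])
      fix q t assume q: "q \<in> U" "t \<in> cbox 0 (1::real)"
      have 1: "(G has_derivative blinfun_apply (G' (l q t))) (at (l q t))"
        by (rule G[OF lU[OF q]])
      have "((\<lambda>p. G (l p t)) has_derivative (\<lambda>v. G' (l q t) (t *\<^sub>R v))) (at q)"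
        by (rule has_derivative_compose[where g = G and f = "\<lambda>p. l p t", OF _ 1]) (auto simp: l_def intro!: derivative_eq_intros)
      then have "((\<lambda>p. G (l p t) (p - c)) has_derivative blinfun_apply (H q t)) (at q)"
        by (auto intro!: derivative_eq_intros simp: H_def fun_eq_iff blinfun.bilinear_simps right_diff_distrib sym[OF lU[OF q]])
      then show "((\<lambda>p. G (l p t) (p - c)) has_derivative blinfun_apply (H q t)) (at q within U)"
        by (rule has_derivative_at_withinI)
    next
      fix q assume q: "q \<in> U"
      have "continuous_on (cbox 0 1) (\<lambda>t. G (l q t))"
        by (rule continuous_on_compose2[OF contG contl2]) (use lU q in auto)
      then show "(\<lambda>t. G (l q t) (q - c)) integrable_on cbox 0 1"
        by (intro integrable_continuous blinfun.continuous_on continuous_on_const)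
    next
      have *: "continuous_on (U \<times> cbox 0 1) (\<lambda>x. l (fst x) (snd x))"
        using contl by (simp add: split_beta)
      have "continuous_on (U \<times> cbox 0 1) (\<lambda>x. G (l (fst x) (snd x)))"
        by (rule continuous_on_compose2[OF contG *]) (use lU in auto)
      moreover have "continuous_on (U \<times> cbox 0 1) (\<lambda>x. G' (l (fst x) (snd x)))"
        by (rule continuous_on_compose2[OF cont *]) (use lU in auto)
      ultimately have "continuous_on (U \<times> cbox 0 1)
          (\<lambda>x. G (l (fst x) (snd x)) + snd x *\<^sub>R G' (l (fst x) (snd x)) (fst x - c))"
        by (intro continuous_on_add continuous_on_scaleR blinfun.continuous_on continuous_on_diff
            continuous_on_fst continuous_on_snd continuous_on_id continuous_on_const)
      then show "continuous_on (U \<times> cbox 0 1) (\<lambda>(q, t). H q t)"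
        by (simp add: split_beta H_def)
    qed
    also have "integral (cbox 0 1) (H p) = G p"
    proof (rule integral_unique)
      have "((\<lambda>t. t *\<^sub>R G (l p t)) has_vector_derivative H p t) (at t within {0..1})" if t: "t \<in> {0..1}" for t
      proof -
        have 1: "(G has_derivative blinfun_apply (G' (l p t))) (at (l p t))"
          using G[OF lU[OF p]] t by simp
        have "((\<lambda>t. G (l p t)) has_derivative (\<lambda>v. G' (l p t) (v *\<^sub>R (p - c)))) (at t)"
          by (rule has_derivative_compose[where g = G and f = "l p", OF _ 1]) (auto simp: l_def[abs_def] intro!: derivative_eq_intros)
        then have "((\<lambda>t. t *\<^sub>R G (l p t)) has_vector_derivative H p t) (at t)"
          unfolding has_vector_derivative_def
          by (auto intro!: derivative_eq_intros simp: H_def fun_eq_iff blinfun.bilinear_simps algebra_simps)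
        then show ?thesis by (rule has_vector_derivative_at_within)
      qed
      from fundamental_theorem_of_calculus[OF _ this]
      show "(H p has_integral G p) (cbox 0 1)" by (simp add: l_def)
    qed
    finally show ?thesis unfolding at_within_open[OF p U(1)] h_def[abs_def] .
  qed
  then show ?thesis by (rule that)
qed

subsection \<open>Calculus of \<open>C\<^sup>2\<close> maps\<close>

text \<open>Makes C2 a two-stage notion: a C2 map is one whose operator-valued derivative is C1.
  Closure properties of C2 then reduce to those of C1 applied to the derivative.\<close>

definition C1_on :: "('v::real_normed_vector \<Rightarrow> 'w::real_normed_vector) \<Rightarrow> 'v set \<Rightarrow> bool" where
  "C1_on f U \<longleftrightarrow> (\<exists>f' :: 'v \<Rightarrow> 'v \<Rightarrow>\<^sub>L 'w.
     (\<forall>p\<in>U. (f has_derivative blinfun_apply (f' p)) (at p)) \<and> continuous_on U f')"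

lemma C1_onI:
  assumes "\<And>p. p \<in> U \<Longrightarrow> (f has_derivative blinfun_apply (f' p)) (at p)" "continuous_on U f'"
  shows "C1_on f U"
  using assms unfolding C1_on_def by blast

lemma C1_onE:
  assumes "C1_on f U"
  obtains f' where "\<And>p. p \<in> U \<Longrightarrow> (f has_derivative blinfun_apply (f' p)) (at p)" "continuous_on U f'"
  using assms unfolding C1_on_def by blast

lemma C2_onI:
  assumes "\<And>p. p \<in> U \<Longrightarrow> (f has_derivative blinfun_apply (f' p)) (at p)" "C1_on f' U"
  shows "C2_on f U"
  using assms unfolding C1_on_def C2_on_def by blast

lemma C2_onE:
  assumes "C2_on f U"
  obtains f' where "\<And>p. p \<in> U \<Longrightarrow> (f has_derivative blinfun_apply (f' p)) (at p)" "C1_on f' U"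
  using assms unfolding C1_on_def C2_on_def by blast

lemma C1_on_imp_continuous_on: "C1_on f U \<Longrightarrow> continuous_on U f"
  by (erule C1_onE) (auto intro!: continuous_at_imp_continuous_on has_derivative_continuous)

lemma C2_on_imp_C1_on:
  assumes "C2_on f U"
  shows "C1_on f U"
proof -
  from assms obtain f' where f':
    "\<And>p. p \<in> U \<Longrightarrow> (f has_derivative blinfun_apply (f' p)) (at p)" "C1_on f' U"
    by (rule C2_onE) blast
  show ?thesis by (rule C1_onI[OF f'(1) C1_on_imp_continuous_on[OF f'(2)]])
qed

lemma C1_on_imp_has_derivative:
  assumes "C1_on f U" "p \<in> U"
  shows "(f has_derivative frechet_derivative f (at p)) (at p)"
  using assms unfolding C1_on_def frechet_derivative_works[symmetric] differentiable_def by metis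

lemma C2_on_imp_frechet_derivative:
  assumes "C2_on f U" "p \<in> U"
  shows "(f has_derivative frechet_derivative f (at p)) (at p)"
  using assms unfolding C2_on_def frechet_derivative_works[symmetric] differentiable_def by metis

lemma has_derivative_cong_open:
  assumes "open U" "p \<in> U" "\<And>q. q \<in> U \<Longrightarrow> f q = g q"
  shows "(f has_derivative D) (at p) \<longleftrightarrow> (g has_derivative D) (at p)"
  using assms has_derivative_transform_within_open[of f D p UNIV U g]
    has_derivative_transform_within_open[of g D p UNIV U f] by auto

lemma C1_on_cong:
  assumes "open U" "\<And>p. p \<in> U \<Longrightarrow> f p = g p"
  shows "C1_on f U \<longleftrightarrow> C1_on g U"
  unfolding C1_on_def using has_derivative_cong_open[OF assms(1) _ assms(2)] by simp

lemma C2_on_cong: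
  assumes "open U" "\<And>p. p \<in> U \<Longrightarrow> f p = g p"
  shows "C2_on f U \<longleftrightarrow> C2_on g U"
  unfolding C2_on_def using has_derivative_cong_open[OF assms(1) _ assms(2)] by simp

lemma C1_on_const: "C1_on (\<lambda>_. c) U"
  by (rule C1_onI[where f' = "\<lambda>_. 0"]) (auto simp: zero_blinfun.rep_eq)

lemma C2_on_const: "C2_on (\<lambda>_. c) U"
  by (rule C2_onI[where f' = "\<lambda>_. 0"]) (auto simp: zero_blinfun.rep_eq intro: C1_on_const)

lemma C2_on_bounded_linear:
  assumes "bounded_linear L"
  shows "C2_on L U"
  by (rule C2_onI[where f' = "\<lambda>_. Blinfun L"])
    (auto simp: bounded_linear_Blinfun_apply assms bounded_linear_imp_has_derivative C1_on_const)

lemma C1_on_compose: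
  assumes "C1_on f V" "C1_on g U" "g ` U \<subseteq> V"
  shows "C1_on (\<lambda>p. f (g p)) U"
proof -
  from assms(1) obtain f' where f':
    "\<And>p. p \<in> V \<Longrightarrow> (f has_derivative blinfun_apply (f' p)) (at p)" "continuous_on V f'"
    by (rule C1_onE) blast
  from assms(2) obtain g' where g':
    "\<And>p. p \<in> U \<Longrightarrow> (g has_derivative blinfun_apply (g' p)) (at p)" "continuous_on U g'"
    by (rule C1_onE) blast
  show ?thesis
  proof (rule C1_onI)
    fix p assume "p \<in> U"
    then show "((\<lambda>p. f (g p)) has_derivative blinfun_apply (f' (g p) o\<^sub>L g' p)) (at p)"
      by (intro has_derivative_eq_rhs[OF has_derivative_compose[OF g'(1) f'(1)]])
        (use assms(3) in auto)
  next
    show "continuous_on U (\<lambda>p. f' (g p) o\<^sub>L g' p)"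
      by (intro continuous_intros g' continuous_on_compose2[OF f'(2) C1_on_imp_continuous_on] assms)
  qed
qed

lemma C1_on_linear:
  "bounded_linear L \<Longrightarrow> C1_on f U \<Longrightarrow> C1_on (\<lambda>p. L (f p)) U"
  by (rule C1_on_compose[OF C2_on_imp_C1_on[OF C2_on_bounded_linear]]) auto

lemma C1_on_add:
  assumes "C1_on f U" "C1_on g U"
  shows "C1_on (\<lambda>p. f p + g p) U"
proof -
  from assms(1) obtain f' where f':
    "\<And>p. p \<in> U \<Longrightarrow> (f has_derivative blinfun_apply (f' p)) (at p)" "continuous_on U f'"
    by (rule C1_onE) blast
  from assms(2) obtain g' where g':
    "\<And>p. p \<in> U \<Longrightarrow> (g has_derivative blinfun_apply (g' p)) (at p)" "continuous_on U g'"
    by (rule C1_onE) blast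
  show ?thesis
    by (rule C1_onI[where f' = "\<lambda>p. f' p + g' p"])
      (auto intro!: continuous_intros f' g' has_derivative_eq_rhs[OF has_derivative_add] simp: blinfun.add_left)
qed

lemma C2_on_add:
  assumes "C2_on f U" "C2_on g U"
  shows "C2_on (\<lambda>p. f p + g p) U"
proof -
  from assms(1) obtain f' where f':
    "\<And>p. p \<in> U \<Longrightarrow> (f has_derivative blinfun_apply (f' p)) (at p)" "C1_on f' U"
    by (rule C2_onE) blast
  from assms(2) obtain g' where g':
    "\<And>p. p \<in> U \<Longrightarrow> (g has_derivative blinfun_apply (g' p)) (at p)" "C1_on g' U"
    by (rule C2_onE) blast
  show ?thesis
    by (rule C2_onI[where f' = "\<lambda>p. f' p + g' p"])
      (auto intro!: C1_on_add f' g' has_derivative_eq_rhs[OF has_derivative_add] simp: blinfun.add_left)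
qed

text \<open>The product rule is stated with operators rather than pointwise, so that the derivative
  is visibly a sum of compositions of maps of known regularity.\<close>

lemma (in bounded_bilinear) has_derivative_prod_Blinfun:
  fixes f :: "'d::real_normed_vector \<Rightarrow> 'a"
  assumes "(f has_derivative blinfun_apply f') (at p)" "(g has_derivative blinfun_apply g') (at p)"
  shows "((\<lambda>p. prod (f p) (g p)) has_derivative
    blinfun_apply ((prod_right (f p) o\<^sub>L g') + (prod_left (g p) o\<^sub>L f'))) (at p)"
  by (rule has_derivative_eq_rhs[OF FDERIV[OF assms]]) (auto simp: blinfun.add_left)

lemma (in bounded_bilinear) C1_on_prod:
  fixes f :: "'d::real_normed_vector \<Rightarrow> 'a"
  assumes "C1_on f U" "C1_on g U"
  shows "C1_on (\<lambda>p. prod (f p) (g p)) U"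
proof -
  from assms(1) obtain f' where f':
    "\<And>p. p \<in> U \<Longrightarrow> (f has_derivative blinfun_apply (f' p)) (at p)" "continuous_on U f'"
    by (rule C1_onE) blast
  from assms(2) obtain g' where g':
    "\<And>p. p \<in> U \<Longrightarrow> (g has_derivative blinfun_apply (g' p)) (at p)" "continuous_on U g'"
    by (rule C1_onE) blast
  show ?thesis
    by (rule C1_onI[OF has_derivative_prod_Blinfun[OF f'(1) g'(1)]])
      (auto intro!: continuous_intros f' g' bounded_linear.continuous_on[OF bounded_linear_prod_right]
        bounded_linear.continuous_on[OF bounded_linear_prod_left] C1_on_imp_continuous_on[OF assms(1)] C1_on_imp_continuous_on[OF assms(2)])
qed

text \<open>The derivative of a product is built by composing operators, which is itself bounded
  bilinear; so the C1 product rule applies a second time, to \<open>o\<^sub>L\<close>.\<close>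

lemma (in bounded_bilinear) C2_on_prod:
  fixes f :: "'d::real_normed_vector \<Rightarrow> 'a"
  assumes "C2_on f U" "C2_on g U"
  shows "C2_on (\<lambda>p. prod (f p) (g p)) U"
proof -
  from assms(1) obtain f' where f':
    "\<And>p. p \<in> U \<Longrightarrow> (f has_derivative blinfun_apply (f' p)) (at p)" "C1_on f' U"
    by (rule C2_onE) blast
  from assms(2) obtain g' where g':
    "\<And>p. p \<in> U \<Longrightarrow> (g has_derivative blinfun_apply (g' p)) (at p)" "C1_on g' U"
    by (rule C2_onE) blast
  show ?thesis
    by (rule C2_onI[OF has_derivative_prod_Blinfun[OF f'(1) g'(1)]])
      (auto intro!: C1_on_add bounded_bilinear.C1_on_prod[OF bounded_bilinear_blinfun_compose] f' g'
        C1_on_linear[OF bounded_linear_prod_right] C1_on_linear[OF bounded_linear_prod_left]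
        C2_on_imp_C1_on[OF assms(1)] C2_on_imp_C1_on[OF assms(2)])
qed

lemmas C1_on_mult = bounded_bilinear.C1_on_prod[OF bounded_bilinear_mult]
lemmas C1_on_scaleR = bounded_bilinear.C1_on_prod[OF bounded_bilinear_scaleR]
lemmas C2_on_mult = bounded_bilinear.C2_on_prod[OF bounded_bilinear_mult]

lemma C2_on_compose:
  assumes "C2_on f V" "C2_on g U" "g ` U \<subseteq> V"
  shows "C2_on (\<lambda>p. f (g p)) U"
proof -
  from assms(1) obtain f' where f':
    "\<And>p. p \<in> V \<Longrightarrow> (f has_derivative blinfun_apply (f' p)) (at p)" "C1_on f' V"
    by (rule C2_onE) blast
  from assms(2) obtain g' where g':
    "\<And>p. p \<in> U \<Longrightarrow> (g has_derivative blinfun_apply (g' p)) (at p)" "C1_on g' U"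
    by (rule C2_onE) blast
  show ?thesis
  proof (rule C2_onI)
    fix p assume "p \<in> U"
    then show "((\<lambda>p. f (g p)) has_derivative blinfun_apply (f' (g p) o\<^sub>L g' p)) (at p)"
      by (intro has_derivative_eq_rhs[OF has_derivative_compose[OF g'(1) f'(1)]])
        (use assms(3) in auto)
  next
    show "C1_on (\<lambda>p. f' (g p) o\<^sub>L g' p) U"
      by (intro bounded_bilinear.C1_on_prod[OF bounded_bilinear_blinfun_compose]
          C1_on_compose[OF f'(2) C2_on_imp_C1_on[OF assms(2)] assms(3)] g')
  qed
qed

lemma C2_on_linear:
  "bounded_linear L \<Longrightarrow> C2_on f U \<Longrightarrow> C2_on (\<lambda>p. L (f p)) U"
  by (rule C2_on_compose[OF C2_on_bounded_linear]) auto

lemma C1_on_minus: "C1_on f U \<Longrightarrow> C1_on (\<lambda>p. - f p) U"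
  by (rule C1_on_linear[OF bounded_linear_minus[OF bounded_linear_ident]])

lemma C1_on_diff: "C1_on f U \<Longrightarrow> C1_on g U \<Longrightarrow> C1_on (\<lambda>p. f p - g p) U"
  using C1_on_add[OF _ C1_on_minus, of f U g] by simp

lemma C2_on_minus: "C2_on f U \<Longrightarrow> C2_on (\<lambda>p. - f p) U"
  by (rule C2_on_linear[OF bounded_linear_minus[OF bounded_linear_ident]])

lemma C2_on_diff: "C2_on f U \<Longrightarrow> C2_on g U \<Longrightarrow> C2_on (\<lambda>p. f p - g p) U"
  using C2_on_add[OF _ C2_on_minus, of f U g] by simp

lemma C2_on_Pair:
  assumes "C2_on f U" "C2_on g U"
  shows "C2_on (\<lambda>p. (f p, g p)) U"
proof -
  have "bounded_linear (\<lambda>x. (x, 0))" "bounded_linear (\<lambda>y. (0, y))"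
    by (auto intro!: bounded_linear_Pair bounded_linear_ident bounded_linear_zero)
  from C2_on_add[OF C2_on_linear[OF this(1) assms(1)] C2_on_linear[OF this(2) assms(2)]]
  show ?thesis by simp
qed

lemma C1_on_field:
  fixes F :: "'a::real_normed_field \<Rightarrow> 'a"
  assumes "\<And>x. x \<in> U \<Longrightarrow> (F has_field_derivative F' x) (at x)" "continuous_on U F'"
  shows "C1_on F U"
proof (rule C1_onI[where f' = "\<lambda>x. bounded_bilinear.prod_right (*) (F' x)"])
  show "(F has_derivative blinfun_apply (bounded_bilinear.prod_right (*) (F' x))) (at x)" if "x \<in> U" for x
    using assms(1)[OF that]
    by (simp add: bounded_bilinear.prod_right.rep_eq[OF bounded_bilinear_mult] has_field_derivative_def)
  show "continuous_on U (\<lambda>x. bounded_bilinear.prod_right (*) (F' x))"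
    by (intro bounded_linear.continuous_on[OF bounded_bilinear.bounded_linear_prod_right[OF bounded_bilinear_mult]] assms)
qed

lemma C2_on_field:
  fixes F :: "'a::real_normed_field \<Rightarrow> 'a"
  assumes "\<And>x. x \<in> U \<Longrightarrow> (F has_field_derivative F' x) (at x)" "C1_on F' U"
  shows "C2_on F U"
proof (rule C2_onI[where f' = "\<lambda>x. bounded_bilinear.prod_right (*) (F' x)"])
  show "(F has_derivative blinfun_apply (bounded_bilinear.prod_right (*) (F' x))) (at x)" if "x \<in> U" for x
    using assms(1)[OF that]
    by (simp add: bounded_bilinear.prod_right.rep_eq[OF bounded_bilinear_mult] has_field_derivative_def)
  show "C1_on (\<lambda>x. bounded_bilinear.prod_right (*) (F' x)) U"
    by (intro C1_on_linear[OF bounded_bilinear.bounded_linear_prod_right[OF bounded_bilinear_mult]] assms)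
qed

lemma C1_on_holomorphic: "F holomorphic_on U \<Longrightarrow> open U \<Longrightarrow> C1_on F U"
  by (rule C1_on_field[where F' = "deriv F"])
    (auto intro: holomorphic_derivI holomorphic_on_imp_continuous_on holomorphic_deriv)

lemma C2_on_holomorphic: "F holomorphic_on U \<Longrightarrow> open U \<Longrightarrow> C2_on F U"
  by (rule C2_on_field[where F' = "deriv F"])
    (auto intro: holomorphic_derivI C1_on_holomorphic holomorphic_deriv)

lemma C1_on_inverse: "C1_on (inverse :: real \<Rightarrow> real) {0<..}"
proof (rule C1_on_field)
  show "(inverse has_real_derivative - (inverse x ^ Suc (Suc 0))) (at x)" if "x \<in> {0<..}" for x :: real
    using that by (intro DERIV_inverse) auto
qed (auto intro!: continuous_intros)

lemma C2_on_ln: "C2_on (ln :: real \<Rightarrow> real) {0<..}"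
  by (rule C2_on_field[where F' = inverse]) (auto intro!: DERIV_ln C1_on_inverse)

text \<open>Evaluation at 1 is bounded linear and carries the operator-valued derivative to
  \<open>deriv\<close>.\<close>

lemma C1_on_deriv:
  fixes F :: "'a::real_normed_field \<Rightarrow> 'a"
  assumes "C2_on F U" "open U" "\<And>x. x \<in> U \<Longrightarrow> F field_differentiable at x"
  shows "C1_on (deriv F) U"
proof -
  from assms(1) obtain F' where F':
    "\<And>p. p \<in> U \<Longrightarrow> (F has_derivative blinfun_apply (F' p)) (at p)" "C1_on F' U"
    by (rule C2_onE) blast
  have "deriv F p = blinfun_apply (F' p) 1" if "p \<in> U" for p
  proof -
    have "(F has_derivative (*) (deriv F p)) (at p)"
      using assms(3)[OF that] DERIV_deriv_iff_field_differentiable has_field_derivative_def by blast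
    from has_derivative_unique[OF this F'(1)[OF that]] show ?thesis by (metis mult.right_neutral)
  qed
  moreover have "C1_on (\<lambda>p. blinfun_apply (F' p) 1) U"
    by (intro C1_on_linear[OF _ F'(2)]) (rule blinfun.bounded_linear_left)
  ultimately show ?thesis using C1_on_cong[OF assms(2), of "deriv F" "\<lambda>p. F' p 1"] by blast
qed

subsection \<open>Logarithmic coordinates on the Heisenberg group\<close>

text \<open>The last two terms of the form are conjugate to each other, so they add up to twice a
  real part.\<close>

lemma contact_form_eq:
  "contact_form p v = complex_of_real (snd v + 2 * Im (cnj (fst p) * fst v))"
  by (simp add: contact_form_def complex_eq_iff)

definition cyl_base :: "real \<times> real \<times> real \<Rightarrow> complex" where
  "cyl_base p = Complex (fst p) (fst (snd p))"

lemma bounded_linear_cyl_base: "bounded_linear cyl_base"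
proof -
  have "cyl_base = (\<lambda>p. of_real (fst p) + of_real (fst (snd p)) * \<i>)"
    by (auto simp: cyl_base_def complex_eq_iff fun_eq_iff)
  moreover have "bounded_linear (\<lambda>p :: real \<times> real \<times> real. of_real (fst p) + of_real (fst (snd p)) * \<i>)"
    by (intro bounded_linear_add bounded_linear_mult_const bounded_linear_compose[OF bounded_linear_of_real]
        bounded_linear_compose[OF bounded_linear_fst] bounded_linear_fst bounded_linear_snd)
  ultimately show ?thesis by simp
qed

lemma open_rect: "open (rect a b)"
proof -
  have "rect a b = {w. 0 < Re w} \<inter> {w. Re w < a} \<inter> {w. 0 < Im w} \<inter> {w. Im w < b}"
    by (auto simp: rect_def)
  then show ?thesis
    by (simp add: open_Int open_halfspace_Re_gt open_halfspace_Re_lt open_halfspace_Im_gt open_halfspace_Im_lt)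
qed

lemma convex_rect: "convex (rect a b)"
proof -
  have "rect a b = {w. 0 < Re w} \<inter> {w. Re w < a} \<inter> {w. 0 < Im w} \<inter> {w. Im w < b}"
    by (auto simp: rect_def)
  then show ?thesis
    by (simp add: convex_Int convex_halfspace_Re_gt convex_halfspace_Re_lt convex_halfspace_Im_gt convex_halfspace_Im_lt)
qed

lemma open_cyl: "open (cyl a b)"
  unfolding cyl_def by (intro open_Times) auto

lemma cyl_base_in_rect: "cyl_base p \<in> rect a b \<longleftrightarrow> p \<in> cyl a b"
  by (cases p) (auto simp: cyl_base_def rect_def cyl_def)

lemma Psi_eq:
  "Psi F p = (complex_of_real (sqrt (Im (F (cyl_base p)))) * cis (snd (snd p)), Re (F (cyl_base p)))"
  by (cases p) (simp add: Psi_def cyl_base_def)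

lemma Pi_map_Psi: "0 \<le> Im (F (cyl_base p)) \<Longrightarrow> Pi_map (Psi F p) = F (cyl_base p)"
  by (simp add: Psi_eq Pi_map_def norm_mult complex_eq_iff)

text \<open>With r^2 = Im F one has dr = Im d / (2 r), and the differential of r e^(i\<theta>) is
  (dr + i r d\<theta>) e^(i\<theta>).\<close>

definition Psi_deriv ::
    "(complex \<Rightarrow> complex) \<Rightarrow> real \<times> real \<times> real \<Rightarrow> real \<times> real \<times> real \<Rightarrow> heis" where
  "Psi_deriv F p u = (let w = cyl_base p; r = sqrt (Im (F w)); d = deriv F w * cyl_base u in
     (Complex (Im d / (2 * r)) (r * snd (snd u)) * cis (snd (snd p)), Re d))"

lemma Psi_has_derivative:
  assumes "(F has_field_derivative deriv F (cyl_base p)) (at (cyl_base p))" "0 < Im (F (cyl_base p))"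
  shows "(Psi F has_derivative Psi_deriv F p) (at p)"
proof -
  have F: "((\<lambda>p. F (cyl_base p)) has_derivative (\<lambda>u. deriv F (cyl_base p) * cyl_base u)) (at p)"
    using has_derivative_compose[OF bounded_linear_imp_has_derivative[OF bounded_linear_cyl_base]
        assms(1)[unfolded has_field_derivative_def]] .
  note Im = bounded_linear.has_derivative[OF bounded_linear_Im F]
  note Re = bounded_linear.has_derivative[OF bounded_linear_Re F]
  have th: "((\<lambda>p :: real \<times> real \<times> real. snd (snd p)) has_derivative (\<lambda>u. snd (snd u))) (at p)"
    by (auto intro!: derivative_eq_intros)
  have "((\<lambda>p. (complex_of_real (sqrt (Im (F (cyl_base p)))) * cis (snd (snd p)), Re (F (cyl_base p))))
      has_derivative Psi_deriv F p) (at p)"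
    apply (rule has_derivative_eq_rhs)
     apply (rule has_derivative_Pair has_derivative_mult has_derivative_of_real has_derivative_cis
        has_derivative_real_sqrt Im Re th assms(2))+
    using assms(2) by (auto simp: fun_eq_iff Psi_deriv_def Let_def complex_eq_iff field_simps)
  then show ?thesis by (simp add: Psi_eq[abs_def])
qed

text \<open>The rotation \<open>c\<close> cancels against its conjugate, leaving the polar identity
  Im(cnj z dz) = r^2 d\<theta> with r^2 = Im F.\<close>

lemma contact_form_Psi_deriv:
  assumes "0 < Im (F (cyl_base p))"
  shows "contact_form (Psi F p) (Psi_deriv F p u) =
    complex_of_real (Re (deriv F (cyl_base p) * cyl_base u) + 2 * Im (F (cyl_base p)) * snd (snd u))"
proof -
  define r where "r = sqrt (Im (F (cyl_base p)))"
  define c where "c = cis (snd (snd p))"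
  define d where "d = deriv F (cyl_base p) * cyl_base u"
  have r: "r * r = Im (F (cyl_base p))" "0 < r" using assms by (simp_all add: r_def)
  have "cnj (of_real r * c) * (Complex (Im d / (2 * r)) (r * snd (snd u)) * c)
      = of_real r * Complex (Im d / (2 * r)) (r * snd (snd u)) * (c * cnj c)"
    by (simp add: algebra_simps)
  also have "c * cnj c = 1" by (simp add: c_def cis_cnj cis_mult)
  finally have *: "cnj (of_real r * c) * (Complex (Im d / (2 * r)) (r * snd (snd u)) * c)
      = of_real r * Complex (Im d / (2 * r)) (r * snd (snd u))" by simp
  show ?thesis
    unfolding contact_form_eq Psi_eq Psi_deriv_def Let_def fst_conv snd_conv
    unfolding r_def[symmetric] c_def[symmetric] d_def[symmetric]
    unfolding * r(1)[symmetric] using r(2) by simp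
qed

text \<open>Rotating the complex component of v back by the angle separates dr and r d\<theta>; then
  dr and dt prescribe the differential of F, which is invertible. This allows the contact condition,
  required for all tangent vectors, to be tested on images of vectors of the cylinder.\<close>

lemma Psi_deriv_surj:
  assumes "0 < Im (F (cyl_base p))" "deriv F (cyl_base p) \<noteq> 0"
  obtains u where "Psi_deriv F p u = v"
proof -
  define r where "r = sqrt (Im (F (cyl_base p)))"
  define c where "c = cis (snd (snd p))"
  define z where "z = fst v * cnj c"
  define w where "w = Complex (snd v) (2 * r * Re z) / deriv F (cyl_base p)"
  have r: "0 < r" using assms by (simp add: r_def)
  have base: "cyl_base (Re w, Im w, Im z / r) = w" by (simp add: cyl_base_def)
  have "Complex (Re z) (Im z) * c = fst v"
    by (simp add: complex_surj) (simp add: z_def c_def mult.assoc cis_cnj cis_mult)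
  moreover have "deriv F (cyl_base p) * w = Complex (snd v) (2 * r * Re z)"
    using assms(2) by (simp add: w_def)
  ultimately have "Psi_deriv F p (Re w, Im w, Im z / r) = v"
    unfolding Psi_deriv_def Let_def base r_def[symmetric] c_def[symmetric]
    using r by (simp add: prod_eq_iff)
  then show ?thesis by (rule that)
qed

text \<open>The determinant of three tangent vectors, read in \<open>heis_coord\<close>.\<close>

definition heis_vol :: "heis \<Rightarrow> heis \<Rightarrow> heis \<Rightarrow> real" where
  "heis_vol x y z =
     snd x * (Re (fst y) * Im (fst z) - Im (fst y) * Re (fst z))
     - snd y * (Re (fst x) * Im (fst z) - Im (fst x) * Re (fst z))
     + snd z * (Re (fst x) * Im (fst y) - Im (fst x) * Re (fst y))"

text \<open>An alternating trilinear form scales by the determinant, which is its value on the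
  images of the standard basis. The sign of the Jacobian can thus be read off from any three vectors
  whose images are known.\<close>

lemma heis_vol_linear:
  assumes "linear L"
  shows "heis_vol (L x) (L y) (L z) = det (matrix (heis_coord \<circ> L \<circ> inv heis_coord)) * heis_vol x y z"
proof -
  interpret linear L by fact
  have inv: "inv heis_coord w = (Complex (w $ 1) (w $ 2), w $ 3)" for w
  proof (rule inv_f_eq)
    show "inj heis_coord"
      by (auto simp: inj_def heis_coord_def vec_eq_iff forall_3 prod_eq_iff complex_eq_iff)
    show "heis_coord (Complex (w $ 1) (w $ 2), w $ 3) = w"
      by (simp add: heis_coord_def vec_eq_iff forall_3)
  qed
  have exp: "L x = Re (fst x) *\<^sub>R L (1, 0) + Im (fst x) *\<^sub>R L (\<i>, 0) + snd x *\<^sub>R L (0, 1)" for x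
  proof -
    have "x = Re (fst x) *\<^sub>R (1, 0) + Im (fst x) *\<^sub>R (\<i>, 0) + snd x *\<^sub>R (0, 1)"
      by (simp add: prod_eq_iff complex_eq_iff)
    then show ?thesis by (metis add scale)
  qed
  have e: "Complex 1 0 = 1" "Complex 0 1 = \<i>" "Complex 0 0 = 0"
    by (simp_all add: complex_eq_iff)
  have m: "det (matrix (heis_coord \<circ> L \<circ> inv heis_coord)) = heis_vol (L (1, 0)) (L (\<i>, 0)) (L (0, 1))"
    by (simp add: det_3 matrix_def inv axis_def e heis_coord_def heis_vol_def algebra_simps)
  show ?thesis unfolding m
    by (subst exp[of x], subst exp[of y], subst exp[of z])
      (simp add: heis_vol_def algebra_simps)
qed

text \<open>The third vector is purely vertical and absorbs the angular components m and n. What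
  remains is half the area spanned by the two differentials of F; the half comes from dr = Im d / (2
  r) multiplied by r.\<close>

lemma heis_vol_Psi_deriv:
  assumes "0 < Im (F (cyl_base p))"
  shows "heis_vol (Psi_deriv F p (\<alpha>, 0, m)) (Psi_deriv F p (0, \<beta>, n)) (Psi_deriv F p (0, 0, 1))
    = \<alpha> * \<beta> * (cmod (deriv F (cyl_base p)))\<^sup>2 / 2"
proof -
  define r where "r = sqrt (Im (F (cyl_base p)))"
  have r: "0 < r" using assms by (simp add: r_def)
  define D where "D = deriv F (cyl_base p)"
  define \<theta> where "\<theta> = snd (snd p)"
  have cb: "cyl_base (\<alpha>, 0, m) = of_real \<alpha>" "cyl_base (0, \<beta>, n) = \<i> * of_real \<beta>" "cyl_base (0, 0, 1) = 0"
    by (simp_all add: cyl_base_def complex_eq_iff)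
  \<comment> \<open>Planar area is invariant under rotation, so the common factor
    \<open>cis \<theta>\<close> drops out.\<close>
  have area: "Re (x * cis \<theta>) * Im (y * cis \<theta>) - Im (x * cis \<theta>) * Re (y * cis \<theta>) = Re x * Im y - Im x * Re y" for x y
  proof -
    have "(x1 * C - x2 * S) * (y1 * S + y2 * C) - (x1 * S + x2 * C) * (y1 * C - y2 * S)
      = (x1 * y2 - x2 * y1) * (C\<^sup>2 + S\<^sup>2)" for x1 x2 y1 y2 C S :: real
      by algebra
    from this[of "Re x" "cos \<theta>" "Im x" "sin \<theta>" "Re y" "Im y"] show ?thesis by simp
  qed
  show ?thesis
    unfolding heis_vol_def Psi_deriv_def Let_def cb
    unfolding r_def[symmetric] D_def[symmetric] \<theta>_def[symmetric] fst_conv snd_conv area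
    using r by (simp add: cmod_power2) (simp add: field_simps power2_eq_square)
qed

subsection \<open>Planar connection forms\<close>

text \<open>The real and imaginary parts of \<open>log_form F\<close> are the partial derivatives of \<open>ln (Im F)\<close>, in reverse
  order.\<close>

definition log_form :: "(complex \<Rightarrow> complex) \<Rightarrow> complex \<Rightarrow> complex" where
  "log_form F w = deriv F w / of_real (Im (F w))"

text \<open>Division by Im F destroys holomorphy, so this quotient rule is only real linear in the
  direction u.\<close>

definition log_form_deriv :: "(complex \<Rightarrow> complex) \<Rightarrow> complex \<Rightarrow> complex \<Rightarrow> complex" where
  "log_form_deriv F w u = deriv (deriv F) w * u / of_real (Im (F w))
     - deriv F w * of_real (Im (deriv F w * u)) / of_real ((Im (F w))\<^sup>2)"

lemma log_form_has_derivative: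
  assumes "F holomorphic_on S" "open S" "w \<in> S" "Im (F w) \<noteq> 0"
  shows "(log_form F has_derivative log_form_deriv F w) (at w)"
proof -
  have F: "(F has_derivative (*) (deriv F w)) (at w)"
    using holomorphic_derivI[OF assms(1-3)] by (simp add: has_field_derivative_def)
  have F': "(deriv F has_derivative (*) (deriv (deriv F) w)) (at w)"
    using holomorphic_derivI[OF holomorphic_deriv[OF assms(1,2)] assms(2,3)]
    by (simp add: has_field_derivative_def)
  note Im = bounded_linear.has_derivative[OF bounded_linear_Im F]
  have "((\<lambda>w. deriv F w / of_real (Im (F w))) has_derivative log_form_deriv F w) (at w)"
    by (rule has_derivative_eq_rhs, rule has_derivative_divide[OF F' has_derivative_of_real[OF Im]])
      (use assms(4) in \<open>auto simp: fun_eq_iff log_form_deriv_def field_simps power2_eq_square\<close>)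
  then show ?thesis by (simp add: log_form_def[abs_def])
qed

lemma C1_on_log_form:
  assumes "F holomorphic_on S" "open S" "\<And>w. w \<in> S \<Longrightarrow> 0 < Im (F w)"
  shows "C1_on (log_form F) S"
proof -
  have "C1_on (\<lambda>w. deriv F w * of_real (inverse (Im (F w)))) S"
    using assms
    by (intro C1_on_mult C1_on_linear[OF bounded_linear_of_real] C1_on_linear[OF bounded_linear_Im]
        C1_on_compose[OF C1_on_inverse] C1_on_holomorphic holomorphic_deriv) auto
  then show ?thesis by (simp add: log_form_def[abs_def] divide_inverse)
qed

text \<open>The left side is the Laplacian of ln (Im F). The terms with the second derivative of F
  cancel since Im F is harmonic, and the square of its gradient, divided by (Im F)^2, remains with a
  minus sign.\<close>

lemma log_form_curl:
  assumes "Im (F w) \<noteq> 0"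
  shows "Im (log_form_deriv F w 1) + Re (log_form_deriv F w \<i>) = - (cmod (deriv F w))\<^sup>2 / (Im (F w))\<^sup>2"
  using assms unfolding log_form_deriv_def cmod_power2
  by (simp add: Re_divide_of_real Im_divide_of_real power2_eq_square field_simps flip: of_real_mult)

lemma log_form_deriv_linear: "linear (log_form_deriv F w)"
  by (auto simp: linear_iff log_form_deriv_def algebra_simps add_divide_distrib diff_divide_distrib scaleR_conv_of_real)

lemma biholomorphic_ontoD:
  assumes "biholomorphic_onto F A B" "open A"
  shows "F holomorphic_on A" "inj_on F A" "F ` A = B" "inv_into A F holomorphic_on B"
    "\<And>w. w \<in> A \<Longrightarrow> F w \<in> B" "\<And>w. w \<in> A \<Longrightarrow> inv_into A F (F w) = w"
    "\<And>w. w \<in> B \<Longrightarrow> inv_into A F w \<in> A" "\<And>w. w \<in> B \<Longrightarrow> F (inv_into A F w) = w"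
    "\<And>w. w \<in> A \<Longrightarrow> deriv F w \<noteq> 0"
  using assms holomorphic_injective_imp_regular[of F A]
  by (auto simp: biholomorphic_onto_def bij_betw_def inv_into_into f_inv_into_f)

lemma Psi_image_cyl:
  assumes "F ` rect a b = \<Omega>" "\<Omega> \<subseteq> upper_half_plane"
  shows "Psi F ` cyl a b = Pi_map -` \<Omega>"
proof (intro equalityI subsetI)
  fix q assume "q \<in> Psi F ` cyl a b"
  then obtain p where p: "p \<in> cyl a b" "q = Psi F p" by blast
  then have "F (cyl_base p) \<in> \<Omega>" using assms(1) cyl_base_in_rect by blast
  moreover from this have "0 \<le> Im (F (cyl_base p))" using assms(2) by (auto simp: upper_half_plane_def)
  ultimately show "q \<in> Pi_map -` \<Omega>" by (simp add: Pi_map_Psi p)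
next
  fix q assume "q \<in> Pi_map -` \<Omega>"
  then have q: "Pi_map q \<in> \<Omega>" by simp
  then obtain w where w: "w \<in> rect a b" "F w = Pi_map q" using assms(1) by (metis imageE)
  \<comment> \<open>The modulus of the first coordinate is already fixed by the imaginary part of
    \<open>Pi_map q\<close>; only the angle has to be chosen.\<close>
  define p where "p = (Re w, Im w, Arg (fst q))"
  have base: "cyl_base p = w" by (simp add: p_def cyl_base_def)
  have "fst q \<noteq> 0" using q assms(2) by (auto simp: Pi_map_def upper_half_plane_def)
  then have "Psi F p = q"
    unfolding Psi_eq base w(2) using rcis_cmod_Arg[of "fst q"]
    by (simp add: Pi_map_def p_def prod_eq_iff rcis_def)
  then show "q \<in> Psi F ` cyl a b" using w(1) base cyl_base_in_rect by blast
qed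

text \<open>Write m for \<Theta>_\<theta>. The planar forms do not depend on \<theta>, so symmetry
  in (s, \<theta>) and (x, \<theta>) gives m_s = m_\<theta> \<open>U\<^sub>0\<close> and m_x =
  m_\<theta> \<open>V\<^sub>0\<close>. Hence m_x \<open>U\<^sub>0\<close> = m_s
  \<open>V\<^sub>0\<close>, and these terms cancel when the two expressions for \<Theta>_sx are
  compared, leaving only the curls.\<close>

lemma contact_lift_curl:
  fixes \<Theta> :: "real \<times> real \<times> real \<Rightarrow> real"
  assumes p: "p \<in> cyl a b"
    and \<Theta>: "\<And>q. q \<in> cyl a b \<Longrightarrow> (\<Theta> has_derivative blinfun_apply (\<Theta>' q)) (at q)"
      "\<And>q. q \<in> cyl a b \<Longrightarrow> (\<Theta>' has_derivative blinfun_apply (\<Theta>'' q)) (at q)"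
      "continuous_on (cyl a b) \<Theta>''"
    and s: "\<And>q. q \<in> cyl a b \<Longrightarrow> \<Theta>' q (1, 0, 0) = \<Theta>' q (0, 0, 1) * U\<^sub>0 (cyl_base q) - U\<^sub>1 (cyl_base q)"
    and x: "\<And>q. q \<in> cyl a b \<Longrightarrow> \<Theta>' q (0, 1, 0) = \<Theta>' q (0, 0, 1) * V\<^sub>0 (cyl_base q) - V\<^sub>1 (cyl_base q)"
    and forms: "(U\<^sub>0 has_derivative U\<^sub>0') (at (cyl_base p))" "(V\<^sub>0 has_derivative V\<^sub>0') (at (cyl_base p))"
      "(U\<^sub>1 has_derivative U\<^sub>1') (at (cyl_base p))" "(V\<^sub>1 has_derivative V\<^sub>1') (at (cyl_base p))"
  shows "\<Theta>' p (0, 0, 1) * (V\<^sub>0' 1 - U\<^sub>0' \<i>) = V\<^sub>1' 1 - U\<^sub>1' \<i>"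
proof -
  have lift: "((\<lambda>q. K (cyl_base q)) has_derivative (\<lambda>v. K' (cyl_base v))) (at p)"
    if "(K has_derivative K') (at (cyl_base p))" for K :: "complex \<Rightarrow> real" and K'
    using has_derivative_compose[OF bounded_linear_imp_has_derivative[OF bounded_linear_cyl_base] that] .
  have ev: "((\<lambda>q. \<Theta>' q u) has_derivative (\<lambda>v. \<Theta>'' p v u)) (at p)" for u
    by (rule bounded_linear.has_derivative[OF blinfun.bounded_linear_left \<Theta>(2)[OF p]])
  have diff: "\<Theta>'' p v u = \<Theta>'' p v (0, 0, 1) * K (cyl_base p) + \<Theta>' p (0, 0, 1) * K' (cyl_base v) - M' (cyl_base v)"
    if "\<And>q. q \<in> cyl a b \<Longrightarrow> \<Theta>' q u = \<Theta>' q (0, 0, 1) * K (cyl_base q) - M (cyl_base q)"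
      "(K has_derivative K') (at (cyl_base p))" "(M has_derivative M') (at (cyl_base p))"
    for u v K K' M M'
  proof -
    have "((\<lambda>q. \<Theta>' q (0, 0, 1) * K (cyl_base q) - M (cyl_base q)) has_derivative
        (\<lambda>v. \<Theta>' p (0, 0, 1) * K' (cyl_base v) + \<Theta>'' p v (0, 0, 1) * K (cyl_base p) - M' (cyl_base v))) (at p)"
      by (rule has_derivative_diff has_derivative_mult ev lift that(2,3))+
    then have "((\<lambda>q. \<Theta>' q u) has_derivative
        (\<lambda>v. \<Theta>' p (0, 0, 1) * K' (cyl_base v) + \<Theta>'' p v (0, 0, 1) * K (cyl_base p) - M' (cyl_base v))) (at p)"
      by (rule has_derivative_cong_open[OF open_cyl p, THEN iffD2, rotated]) (rule that(1))
    from fun_cong[OF has_derivative_unique[OF ev this], of v] show ?thesis by simp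
  qed
  have sym: "\<Theta>'' p u v = \<Theta>'' p v u" for u v
    by (rule second_derivative_symmetric[OF open_cyl p \<Theta>])
  \<comment> \<open>The vertical direction projects to 0 in the plane, where the derivatives of the
    planar forms vanish.\<close>
  have zero: "U\<^sub>0' 0 = 0" "V\<^sub>0' 0 = 0" "U\<^sub>1' 0 = 0" "V\<^sub>1' 0 = 0"
    using forms[THEN has_derivative_linear, THEN linear_0] by auto
  have base: "cyl_base (1, 0, 0) = 1" "cyl_base (0, 1, 0) = \<i>" "cyl_base (0, 0, 1) = 0"
    by (simp_all add: cyl_base_def complex_eq_iff)
  note U = diff[OF s forms(1,3)] and V = diff[OF x forms(2,4)]
  show ?thesis
    using U[of "(0, 1, 0)"] U[of "(0, 0, 1)"] V[of "(1, 0, 0)"] V[of "(0, 0, 1)"]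
      sym[of "(1, 0, 0)" "(0, 1, 0)"] sym[of "(1, 0, 0)" "(0, 0, 1)"] sym[of "(0, 1, 0)" "(0, 0, 1)"]
    unfolding base zero by algebra
qed

section \<open>Auxiliary facts on circles, partial derivatives and regularity\<close>

lemma cis_add_cancel:
  assumes "cis (x + 2 * pi * t) = cis x"
  shows "t \<in> \<int>"
proof -
  have "cis x * cis (2 * pi * t) = cis x * 1" using assms by (simp add: cis_mult)
  then have "cis (2 * pi * t) = 1" by (metis cis_neq_zero mult_left_cancel)
  then have "cos (2 * pi * t) = 1" by (simp add: complex_eq_iff)
  then obtain n :: int where "2 * pi * t = of_int n * 2 * pi" by (auto simp: cos_one_2pi_int)
  then have "t = of_int n" by simp
  then show ?thesis by simp
qed

lemma pos_Int_inverse_Int: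
  fixes m :: real
  assumes "m \<in> \<int>" "1 / m \<in> \<int>" "0 < m"
  shows "m = 1"
proof -
  obtain n where n: "m = of_int n" using assms(1) by (rule Ints_cases)
  obtain n' where n': "1 / m = of_int n'" using assms(2) by (rule Ints_cases)
  have "1 \<le> m" using n assms(3) by simp
  moreover have "0 < 1 / m" using assms(3) by simp
  then have "1 \<le> 1 / m" using n' by simp
  then have "m \<le> 1" using assms(3) by (simp add: field_simps)
  ultimately show ?thesis by simp
qed

lemma has_derivative_Complex:
  assumes "(f has_derivative f') F" "(g has_derivative g') F"
  shows "((\<lambda>x. Complex (f x) (g x)) has_derivative (\<lambda>x. Complex (f' x) (g' x))) F"
  unfolding Complex_eq by (intro has_derivative_add has_derivative_of_real has_derivative_mult_right assms)

lemma partial_s_eq: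
  assumes "(F has_field_derivative deriv F (Complex s x)) (at (Complex s x))"
  shows "partial_s F s x = deriv F (Complex s x)"
proof -
  have "((\<lambda>\<sigma>. Complex \<sigma> x) has_vector_derivative 1) (at s)"
    using has_derivative_Complex[OF has_derivative_ident has_derivative_const]
    by (simp add: has_vector_derivative_def complex_eq_iff Complex_eq scaleR_conv_of_real)
  from field_vector_diff_chain_at[OF this assms]
  show ?thesis unfolding partial_s_def o_def by (simp add: vector_derivative_at)
qed

lemma C2_on_exp: "C2_on (exp :: complex \<Rightarrow> complex) UNIV"
  by (rule C2_on_holomorphic) (auto intro: holomorphic_intros)

lemma C2_on_Pi_map: "C2_on Pi_map U"
proof -
  have "C2_on (\<lambda>p :: heis. of_real (snd p) + \<i> * (fst p * cnj (fst p))) U"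
    by (intro C2_on_add C2_on_mult C2_on_const C2_on_linear[OF bounded_linear_of_real]
        C2_on_linear[OF bounded_linear_cnj] C2_on_bounded_linear bounded_linear_fst bounded_linear_snd)
  moreover have "Pi_map = (\<lambda>p. of_real (snd p) + \<i> * (fst p * cnj (fst p)))"
    by (simp add: fun_eq_iff Pi_map_def complex_eq_iff cmod_power2 flip: power2_eq_square)
  ultimately show ?thesis by simp
qed

text \<open>The modulus of the fibre factor of the lift is sqrt (y / x); in this exponential form
  its regularity follows from that of \<open>exp\<close> and \<open>ln\<close>.\<close>

lemma sqrt_mult_exp_half_ln:
  assumes "0 < x" "0 < y"
  shows "sqrt x * exp ((ln y - ln x) * (1 / 2)) = sqrt y"
proof -
  have "exp ((ln y - ln x) * (1 / 2)) = exp (ln (sqrt y)) / exp (ln (sqrt x))"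
    using assms by (simp add: ln_sqrt diff_divide_distrib exp_diff)
  then show ?thesis using assms by simp
qed

subsection \<open>The stretch map and its lifts\<close>

locale stretch =
  fixes a b a' b' :: real
    and phi psi :: "complex \<Rightarrow> complex"
    and \<Omega> \<Omega>' :: "complex set"
    and \<phi> :: "real \<Rightarrow> real"
  assumes pos: "0 < a" "0 < b" "0 < a'" "0 < b'"
    and domains: "open \<Omega>" "\<Omega> \<subseteq> upper_half_plane" "open \<Omega>'" "\<Omega>' \<subseteq> upper_half_plane"
    and phi: "biholomorphic_onto phi (rect a b) \<Omega>"
    and psi: "biholomorphic_onto psi (rect a' b') \<Omega>'"
    and varphi: "\<phi> 0 = 0" "\<phi> b = b'" "continuous_on {0..b} \<phi>" "\<phi> differentiable_on {0<..<b}"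
      "\<And>x. x \<in> {0<..<b} \<Longrightarrow> a' / a \<le> deriv \<phi> x"
    and g_regular: "C2_on (g_map a b a' phi psi \<phi>) \<Omega>"
begin

abbreviation "R \<equiv> rect a b"
abbreviation "R' \<equiv> rect a' b'"
abbreviation "g \<equiv> g_map a b a' phi psi \<phi>"
abbreviation "fm \<equiv> f_map a a' \<phi>"

definition k where "k = a' / a"

lemma k_pos: "0 < k" using pos by (simp add: k_def)

lemmas phiD = biholomorphic_ontoD[OF phi open_rect]
lemmas psiD = biholomorphic_ontoD[OF psi open_rect]

section \<open>Bijectivity and regularity of the stretch\<close>

lemma Im_phi: "w \<in> R \<Longrightarrow> 0 < Im (phi w)"
  using phiD(5) domains(2) by (auto simp: upper_half_plane_def)

lemma Im_psi: "w \<in> R' \<Longrightarrow> 0 < Im (psi w)"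
  using psiD(5) domains(4) by (auto simp: upper_half_plane_def)

lemma varphi_field_differentiable: "x \<in> {0<..<b} \<Longrightarrow> \<phi> field_differentiable at x"
  using varphi(4) by (simp add: differentiable_on_eq_differentiable_at real_differentiable_def
      field_differentiable_def)

lemma varphi_DERIV: "x \<in> {0<..<b} \<Longrightarrow> (\<phi> has_real_derivative deriv \<phi> x) (at x)"
  using varphi_field_differentiable DERIV_deriv_iff_field_differentiable by blast

lemma deriv_varphi_pos: "x \<in> {0<..<b} \<Longrightarrow> 0 < deriv \<phi> x"
  using varphi(5)[of x] k_pos by (auto simp: k_def)

lemma varphi_less: "0 \<le> x \<Longrightarrow> x < y \<Longrightarrow> y \<le> b \<Longrightarrow> \<phi> x < \<phi> y"
  by (rule DERIV_pos_imp_increasing_open)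
    (auto intro!: exI varphi_DERIV deriv_varphi_pos continuous_on_subset[OF varphi(3)])

lemma varphi_in: "x \<in> {0<..<b} \<Longrightarrow> \<phi> x \<in> {0<..<b'}"
  using varphi_less[of 0 x] varphi_less[of x b] varphi(1,2) by auto

lemma varphi_onto:
  assumes "y \<in> {0<..<b'}"
  obtains x where "x \<in> {0<..<b}" "\<phi> x = y"
proof -
  obtain x where x: "0 \<le> x" "x \<le> b" "\<phi> x = y"
    using IVT'[of \<phi> 0 y b] assms varphi pos by auto
  moreover from this have "x \<noteq> 0" "x \<noteq> b" using assms varphi(1,2) by auto
  ultimately show ?thesis by (intro that[of x]) auto
qed

lemma fm_eq: "fm w = Complex (k * Re w) (\<phi> (Im w))"
  by (simp add: f_map_def k_def)

lemma fm_in: "w \<in> R \<Longrightarrow> fm w \<in> R'"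
  using varphi_in[of "Im w"] pos by (auto simp: fm_eq rect_def k_def field_simps)

lemma fm_inj: "w \<in> R \<Longrightarrow> z \<in> R \<Longrightarrow> fm w = fm z \<Longrightarrow> w = z"
  using k_pos varphi_less[of "Im w" "Im z"] varphi_less[of "Im z" "Im w"]
  by (cases "Im w" "Im z" rule: linorder_cases) (auto simp: fm_eq rect_def complex_eq_iff)

lemma fm_onto:
  assumes "z \<in> R'"
  obtains w where "w \<in> R" "fm w = z"
proof -
  obtain x where x: "x \<in> {0<..<b}" "\<phi> x = Im z"
    using varphi_onto[of "Im z"] assms by (auto simp: rect_def)
  show ?thesis
    by (rule that[of "Complex (Re z / k) x"])
      (use x assms k_pos pos in \<open>auto simp: rect_def fm_eq complex_eq_iff k_def field_simps\<close>)
qed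

lemma g_phi: "w \<in> R \<Longrightarrow> g (phi w) = psi (fm w)"
  by (simp add: g_map_def phiD(6))

lemma g_in: "w \<in> \<Omega> \<Longrightarrow> g w \<in> \<Omega>'"
  by (metis g_phi phiD(7,8) fm_in psiD(5))

lemma g_inj:
  assumes "w \<in> \<Omega>" "z \<in> \<Omega>" "g w = g z"
  shows "w = z"
proof -
  have "psi (fm (inv_into R phi w)) = psi (fm (inv_into R phi z))"
    using assms g_phi[OF phiD(7)] phiD(8) by metis
  then have "inv_into R phi w = inv_into R phi z"
    using fm_inj fm_in psiD(2) phiD(7) assms(1,2) by (meson inj_onD)
  then show ?thesis using phiD(8) assms(1,2) by metis
qed

text \<open>On the vertical segment over a / 2 (any abscissa inside would do), \<phi> is the
  imaginary part of the inverse of psi applied to g composed with phi, hence as regular as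
  g.\<close>

lemma C2_varphi: "C2_on \<phi> {0<..<b}"
proof -
  define l where "l x = of_real (a / 2) + of_real x * \<i>" for x :: real
  have l: "C2_on l {0<..<b}"
    unfolding l_def
    by (intro C2_on_add C2_on_const C2_on_linear[OF bounded_linear_mult_left] C2_on_bounded_linear bounded_linear_of_real)
  have lR: "l x \<in> R" if "x \<in> {0<..<b}" for x
    using that pos by (auto simp: l_def rect_def)
  have "C2_on (\<lambda>x. g (phi (l x))) {0<..<b}"
  proof (rule C2_on_compose[OF g_regular C2_on_compose[OF C2_on_holomorphic[OF phiD(1) open_rect] l]])
  qed (use lR phiD(5) in auto)
  then have "C2_on (\<lambda>x. inv_into R' psi (g (phi (l x)))) {0<..<b}"
    by (rule C2_on_compose[OF C2_on_holomorphic[OF psiD(4) domains(3)]]) (use lR phiD(5) g_in in auto)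
  from C2_on_linear[OF bounded_linear_Im this]
  have "C2_on (\<lambda>x. Im (inv_into R' psi (g (phi (l x))))) {0<..<b}" .
  moreover have "Im (inv_into R' psi (g (phi (l x)))) = \<phi> x" if "x \<in> {0<..<b}" for x
    using g_phi[OF lR[OF that]] psiD(6)[OF fm_in[OF lR[OF that]]] by (simp add: fm_eq l_def)
  ultimately show ?thesis
    using C2_on_cong[of "{0<..<b}" \<phi> "\<lambda>x. Im (inv_into R' psi (g (phi (l x))))"] by simp
qed

lemma C1_deriv_varphi: "C1_on (deriv \<phi>) {0<..<b}"
  by (rule C1_on_deriv[OF C2_varphi _ varphi_field_differentiable]) auto

lemma Im_R: "w \<in> R \<Longrightarrow> Im w \<in> {0<..<b}" by (simp add: rect_def)

lemma C2_fm: "C2_on fm R"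
proof -
  have "C2_on (\<lambda>w. of_real (k * Re w) + of_real (\<phi> (Im w)) * \<i>) R"
    by (intro C2_on_add C2_on_linear[OF bounded_linear_of_real] C2_on_linear[OF bounded_linear_mult_left]
        C2_on_linear[OF bounded_linear_mult_right] C2_on_compose[OF C2_varphi]
        C2_on_bounded_linear bounded_linear_Re bounded_linear_Im) (use Im_R in auto)
  moreover have "fm = (\<lambda>w. of_real (k * Re w) + of_real (\<phi> (Im w)) * \<i>)"
    by (auto simp: fm_eq complex_eq_iff)
  ultimately show ?thesis by simp
qed

definition fm_deriv where "fm_deriv w u = Complex (k * Re u) (deriv \<phi> (Im w) * Im u)"

lemma varphi_Im_has_derivative:
  "w \<in> R \<Longrightarrow> ((\<lambda>w. \<phi> (Im w)) has_derivative (\<lambda>u. deriv \<phi> (Im w) * Im u)) (at w)"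
  using has_derivative_compose[OF bounded_linear_imp_has_derivative[OF bounded_linear_Im]
      varphi_DERIV[OF Im_R, unfolded has_field_derivative_def], of w] by simp

lemma fm_has_derivative:
  assumes "w \<in> R"
  shows "(fm has_derivative fm_deriv w) (at w)"
proof -
  have "((\<lambda>w. of_real (k * Re w) + of_real (\<phi> (Im w)) * \<i>) has_derivative fm_deriv w) (at w)"
    by (rule has_derivative_eq_rhs)
      (rule derivative_eq_intros varphi_Im_has_derivative[OF assms] refl |
        simp add: fm_deriv_def fun_eq_iff complex_eq_iff)+
  moreover have "fm = (\<lambda>w. of_real (k * Re w) + of_real (\<phi> (Im w)) * \<i>)"
    by (auto simp: fm_eq complex_eq_iff)
  ultimately show ?thesis by simp
qed

section \<open>The planar forms and their curls\<close>

text \<open>The index 0 refers to the source and 1 to the pull back of the target under \<open>f_map\<close>;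
  \<open>\<kappa> = V\<^sub>s - U\<^sub>x\<close> is the curl of \<open>U ds + V dx\<close>.\<close>

definition "U\<^sub>0 w = Re (log_form phi w) / 2"
definition "V\<^sub>0 w = - Im (log_form phi w) / 2"
definition "U\<^sub>1 w = k * Re (log_form psi (fm w)) / 2"
definition "V\<^sub>1 w = - deriv \<phi> (Im w) * Im (log_form psi (fm w)) / 2"

definition "\<kappa>\<^sub>0 w = (cmod (deriv phi w))\<^sup>2 / (2 * (Im (phi w))\<^sup>2)"
definition "\<kappa>\<^sub>1 w = k * deriv \<phi> (Im w) * (cmod (deriv psi (fm w)))\<^sup>2 / (2 * (Im (psi (fm w)))\<^sup>2)"

lemma \<kappa>\<^sub>0_pos: "w \<in> R \<Longrightarrow> 0 < \<kappa>\<^sub>0 w"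
  using phiD(9) Im_phi by (force simp: \<kappa>\<^sub>0_def)

lemma \<kappa>\<^sub>1_pos: "w \<in> R \<Longrightarrow> 0 < \<kappa>\<^sub>1 w"
  using psiD(9)[OF fm_in] Im_psi[OF fm_in] k_pos deriv_varphi_pos[OF Im_R] by (force simp: \<kappa>\<^sub>1_def)

text \<open>The left side of the star condition is the quotient of \<open>\<kappa>\<^sub>1\<close>
  by \<open>\<kappa>\<^sub>0\<close>; the factors 1 / 2 cancel.\<close>

lemma star_iff: "star_condition a b a' phi psi \<phi> \<longleftrightarrow> (\<forall>w\<in>R. \<kappa>\<^sub>1 w = \<kappa>\<^sub>0 w)"
proof -
  have *: "\<kappa>\<^sub>1 w = \<kappa>\<^sub>0 w \<longleftrightarrow> a' / a * deriv \<phi> (Im w) *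
        (((cmod (deriv psi (fm w)))\<^sup>2 * (Im (phi w))\<^sup>2) / ((cmod (deriv phi w))\<^sup>2 * (Im (psi (fm w)))\<^sup>2)) = 1"
    if "w \<in> R" for w
    using pos phiD(9)[OF that] Im_phi[OF that] psiD(9)[OF fm_in[OF that]] Im_psi[OF fm_in[OF that]]
    by (auto simp: \<kappa>\<^sub>0_def \<kappa>\<^sub>1_def k_def field_simps)
  show ?thesis
    unfolding star_condition_def
  proof (intro iffI ballI)
    fix w assume "\<forall>s\<in>{0<..<a}. \<forall>x\<in>{0<..<b}. a' / a * deriv \<phi> x *
        (((cmod (deriv psi (Complex (a' / a * s) (\<phi> x))))\<^sup>2 * (Im (phi (Complex s x)))\<^sup>2) /
         ((cmod (deriv phi (Complex s x)))\<^sup>2 * (Im (psi (Complex (a' / a * s) (\<phi> x))))\<^sup>2)) = 1" and w: "w \<in> R"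
    moreover have "Re w \<in> {0<..<a}" "Im w \<in> {0<..<b}" using w by (auto simp: rect_def)
    ultimately show "\<kappa>\<^sub>1 w = \<kappa>\<^sub>0 w" unfolding *[OF w] f_map_def by (metis complex_surj)
  next
    fix s x assume eq: "\<forall>w\<in>R. \<kappa>\<^sub>1 w = \<kappa>\<^sub>0 w" and "s \<in> {0<..<a}" "x \<in> {0<..<b}"
    then have w: "Complex s x \<in> R" by (simp add: rect_def)
    then show "a' / a * deriv \<phi> x *
        (((cmod (deriv psi (Complex (a' / a * s) (\<phi> x))))\<^sup>2 * (Im (phi (Complex s x)))\<^sup>2) /
         ((cmod (deriv phi (Complex s x)))\<^sup>2 * (Im (psi (Complex (a' / a * s) (\<phi> x))))\<^sup>2)) = 1"
      using *[OF w] eq unfolding f_map_def complex.sel by blast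
  qed
qed

lemma C1_forms: "C1_on U\<^sub>0 R" "C1_on V\<^sub>0 R" "C1_on U\<^sub>1 R" "C1_on V\<^sub>1 R"
proof -
  have 0: "C1_on (log_form phi) R"
    by (rule C1_on_log_form[OF phiD(1) open_rect Im_phi])
  have 1: "C1_on (\<lambda>w. log_form psi (fm w)) R"
    by (rule C1_on_compose[OF C1_on_log_form[OF psiD(1) open_rect Im_psi] C2_on_imp_C1_on[OF C2_fm]])
      (use fm_in in auto)
  have 2: "C1_on (\<lambda>w. deriv \<phi> (Im w)) R"
    by (rule C1_on_compose[OF C1_deriv_varphi C2_on_imp_C1_on[OF C2_on_bounded_linear[OF bounded_linear_Im]]])
      (use Im_R in auto)
  note Re = C1_on_linear[OF bounded_linear_Re] and Im = C1_on_linear[OF bounded_linear_Im]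
  have "C1_on (\<lambda>w. Re (log_form phi w) * (1 / 2)) R" by (intro C1_on_mult C1_on_const Re 0)
  then show "C1_on U\<^sub>0 R" by (simp add: U\<^sub>0_def[abs_def])
  have "C1_on (\<lambda>w. Im (log_form phi w) * (- 1 / 2)) R" by (intro C1_on_mult C1_on_const Im 0)
  then show "C1_on V\<^sub>0 R" by (simp add: V\<^sub>0_def[abs_def])
  have "C1_on (\<lambda>w. Re (log_form psi (fm w)) * (k / 2)) R" by (intro C1_on_mult C1_on_const Re 1)
  then show "C1_on U\<^sub>1 R" by (simp add: U\<^sub>1_def[abs_def] mult.commute)
  have "C1_on (\<lambda>w. deriv \<phi> (Im w) * Im (log_form psi (fm w)) * (- 1 / 2)) R"
    by (intro C1_on_mult C1_on_const Im 1 2)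
  then show "C1_on V\<^sub>1 R" by (simp add: V\<^sub>1_def[abs_def])
qed

lemma form\<^sub>0_curl:
  assumes w: "w \<in> R" and U: "(U\<^sub>0 has_derivative U') (at w)" and V: "(V\<^sub>0 has_derivative V') (at w)"
  shows "V' 1 - U' \<i> = \<kappa>\<^sub>0 w"
proof -
  have N: "(log_form phi has_derivative log_form_deriv phi w) (at w)"
    by (rule log_form_has_derivative[OF phiD(1) open_rect w]) (use Im_phi[OF w] in simp)
  have "(U\<^sub>0 has_derivative (\<lambda>u. Re (log_form_deriv phi w u) / 2)) (at w)"
    unfolding U\<^sub>0_def[abs_def] by (auto intro!: derivative_eq_intros N)
  from has_derivative_unique[OF U this] have 1: "U' \<i> = Re (log_form_deriv phi w \<i>) / 2" by simp
  have "(V\<^sub>0 has_derivative (\<lambda>u. - Im (log_form_deriv phi w u) / 2)) (at w)"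
    unfolding V\<^sub>0_def[abs_def] by (auto intro!: derivative_eq_intros N)
  from has_derivative_unique[OF V this] have 2: "V' 1 = - Im (log_form_deriv phi w 1) / 2" by simp
  show ?thesis
    unfolding 1 2 \<kappa>\<^sub>0_def using log_form_curl[of phi w] Im_phi[OF w] by (simp add: field_simps)
qed

text \<open>The stretch scales the directions 1 and \<i> by k and \<phi>', so the curl of the form
  of psi is multiplied by the Jacobian k \<phi>'.\<close>

lemma form\<^sub>1_curl:
  assumes w: "w \<in> R" and U: "(U\<^sub>1 has_derivative U') (at w)" and V: "(V\<^sub>1 has_derivative V') (at w)"
  shows "V' 1 - U' \<i> = \<kappa>\<^sub>1 w"
proof -
  have "(log_form psi has_derivative log_form_deriv psi (fm w)) (at (fm w))"
    by (rule log_form_has_derivative[OF psiD(1) open_rect fm_in[OF w]]) (use Im_psi[OF fm_in[OF w]] in simp)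
  from has_derivative_compose[OF fm_has_derivative[OF w] this]
  have N: "((\<lambda>w. log_form psi (fm w)) has_derivative (\<lambda>u. log_form_deriv psi (fm w) (fm_deriv w u))) (at w)" .
  have "(deriv \<phi> has_real_derivative deriv (deriv \<phi>) (Im w)) (at (Im w))"
    using C1_deriv_varphi Im_R[OF w] unfolding C1_on_def
    by (metis DERIV_deriv_iff_real_differentiable differentiableI)
  from has_derivative_compose[OF bounded_linear_imp_has_derivative[OF bounded_linear_Im] this[unfolded has_field_derivative_def]]
  have D: "((\<lambda>w. deriv \<phi> (Im w)) has_derivative (\<lambda>u. deriv (deriv \<phi>) (Im w) * Im u)) (at w)" .
  have "(U\<^sub>1 has_derivative (\<lambda>u. k * Re (log_form_deriv psi (fm w) (fm_deriv w u)) / 2)) (at w)"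
    unfolding U\<^sub>1_def[abs_def] by (auto intro!: derivative_eq_intros N)
  from has_derivative_unique[OF U this]
  have 1: "U' \<i> = k * Re (log_form_deriv psi (fm w) (fm_deriv w \<i>)) / 2" by simp
  \<comment> \<open>The term with the second derivative of \<phi> carries the factor Im u and so
    vanishes in the direction 1, the only one that the curl takes from
    \<open>V\<^sub>1\<close>.\<close>
  have "(V\<^sub>1 has_derivative (\<lambda>u. (- deriv \<phi> (Im w) * Im (log_form_deriv psi (fm w) (fm_deriv w u))
      - deriv (deriv \<phi>) (Im w) * Im u * Im (log_form psi (fm w))) / 2)) (at w)"
    unfolding V\<^sub>1_def[abs_def]
    by (rule has_derivative_eq_rhs, (rule derivative_intros N D bounded_linear.has_derivative[OF bounded_linear_Im])+)
      (auto simp: fun_eq_iff field_simps)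
  from has_derivative_unique[OF V this]
  have 2: "V' 1 = - deriv \<phi> (Im w) * Im (log_form_deriv psi (fm w) (fm_deriv w 1)) / 2" by simp
  have e: "fm_deriv w 1 = k *\<^sub>R 1" "fm_deriv w \<i> = deriv \<phi> (Im w) *\<^sub>R \<i>"
    by (simp_all add: fm_deriv_def complex_eq_iff)
  have "V' 1 - U' \<i> = - (k * deriv \<phi> (Im w) / 2) * (Im (log_form_deriv psi (fm w) 1) + Re (log_form_deriv psi (fm w) \<i>))"
    unfolding 1 2 e linear_scale[OF log_form_deriv_linear] by (simp add: algebra_simps add_divide_distrib)
  also have "\<dots> = \<kappa>\<^sub>1 w"
  proof -
    have "Im (psi (fm w)) \<noteq> 0" using Im_psi[OF fm_in[OF w]] by simp
    from log_form_curl[of psi "fm w", OF this] show ?thesis by (simp add: \<kappa>\<^sub>1_def)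
  qed
  finally show ?thesis .
qed

lemma holo_phi: "w \<in> R \<Longrightarrow> (phi has_field_derivative deriv phi w) (at w)"
  by (rule holomorphic_derivI[OF phiD(1) open_rect])

lemma holo_psi: "w \<in> R' \<Longrightarrow> (psi has_field_derivative deriv psi w) (at w)"
  by (rule holomorphic_derivI[OF psiD(1) open_rect])

text \<open>This fixes the sign and the factor 1 / 2 in \<open>U\<^sub>0\<close> and
  \<open>V\<^sub>0\<close>: the form is divided by 2 Im phi, its coefficient at d\<theta>.\<close>

lemma Re_deriv_phi:
  assumes "w \<in> R"
  shows "Re (deriv phi w * u) = 2 * Im (phi w) * (U\<^sub>0 w * Re u + V\<^sub>0 w * Im u)"
proof -
  have "Im (phi w) \<noteq> 0" using Im_phi[OF assms] by simp
  then have "x * Re u - y * Im u = 2 * Im (phi w) * (x / Im (phi w) / 2 * Re u + - (y / Im (phi w)) / 2 * Im u)" for x y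
    by (simp add: field_simps)
  then show ?thesis by (simp add: U\<^sub>0_def V\<^sub>0_def log_form_def Re_divide_of_real Im_divide_of_real)
qed

lemma Re_deriv_psi:
  assumes "w \<in> R"
  shows "Re (deriv psi (fm w) * fm_deriv w u) = 2 * Im (psi (fm w)) * (U\<^sub>1 w * Re u + V\<^sub>1 w * Im u)"
proof -
  have "Im (psi (fm w)) \<noteq> 0" using Im_psi[OF fm_in[OF assms]] by simp
  then have "x * (k * Re u) - y * (d * Im u)
      = 2 * Im (psi (fm w)) * (k * (x / Im (psi (fm w))) / 2 * Re u + - d * (y / Im (psi (fm w))) / 2 * Im u)" for x y d
    by (simp add: field_simps)
  then show ?thesis
    by (simp add: U\<^sub>1_def V\<^sub>1_def fm_deriv_def log_form_def Re_divide_of_real Im_divide_of_real)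
qed

section \<open>The contact form on the cylinder and its pull back\<close>

lemma contact_form_source:
  assumes "p \<in> cyl a b"
  shows "contact_form (Psi phi p) (Psi_deriv phi p u) = complex_of_real (2 * Im (phi (cyl_base p)) *
    (U\<^sub>0 (cyl_base p) * Re (cyl_base u) + V\<^sub>0 (cyl_base p) * Im (cyl_base u) + snd (snd u)))"
proof -
  have w: "cyl_base p \<in> R" using assms by (simp add: cyl_base_in_rect)
  show ?thesis
    unfolding contact_form_Psi_deriv[of phi p, OF Im_phi[OF w]] Re_deriv_phi[OF w]
    by (simp only: distrib_left)
qed

text \<open>Only the planar part of T and T' is prescribed. The angular part stays free, so the
  formula serves both for an unknown \<Theta> and for the constructed lift.\<close>

lemma contact_form_target:
  assumes p: "p \<in> cyl a b" and T: "cyl_base (T p) = fm (cyl_base p)"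
    and T': "cyl_base (T' u) = fm_deriv (cyl_base p) (cyl_base u)"
  shows "contact_form (Psi psi (T p)) (Psi_deriv psi (T p) (T' u)) = complex_of_real (2 * Im (psi (fm (cyl_base p))) *
    (U\<^sub>1 (cyl_base p) * Re (cyl_base u) + V\<^sub>1 (cyl_base p) * Im (cyl_base u) + snd (snd (T' u))))"
proof -
  have w: "cyl_base p \<in> R" using p by (simp add: cyl_base_in_rect)
  show ?thesis
    unfolding contact_form_Psi_deriv[of psi "T p", unfolded T, OF Im_psi[OF fm_in[OF w]]] T' Re_deriv_psi[OF w]
    by (simp only: distrib_left)
qed

text \<open>Both sides of the relation between f and T are differentiated by the chain rule and
  compared by uniqueness. The derivative of T needs no separate assumption: its planar part is that
  of the stretch.\<close>

lemma lift_deriv: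
  assumes p: "p \<in> cyl a b"
    and T: "\<And>q. q \<in> cyl a b \<Longrightarrow> cyl_base (T q) = fm (cyl_base q)"
    and \<Theta>: "((\<lambda>q. snd (snd (T q))) has_derivative \<Theta>') (at p)"
    and D: "(f has_derivative D) (at (Psi phi p))"
    and f: "\<And>q. q \<in> cyl a b \<Longrightarrow> f (Psi phi q) = Psi psi (T q)"
  shows "D (Psi_deriv phi p u) = Psi_deriv psi (T p)
    (Re (fm_deriv (cyl_base p) (cyl_base u)), Im (fm_deriv (cyl_base p) (cyl_base u)), \<Theta>' u)"
proof -
  define w where "w = cyl_base p"
  have w: "w \<in> R" using p by (simp add: w_def cyl_base_in_rect)
  define T' where "T' u = (Re (fm_deriv w (cyl_base u)), Im (fm_deriv w (cyl_base u)), \<Theta>' u)" for u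
  have fm: "((\<lambda>p. fm (cyl_base p)) has_derivative (\<lambda>u. fm_deriv w (cyl_base u))) (at p)"
    using has_derivative_compose[OF bounded_linear_imp_has_derivative[OF bounded_linear_cyl_base]
        fm_has_derivative[OF w, unfolded w_def]] by (simp add: w_def)
  have "((\<lambda>p. (Re (fm (cyl_base p)), Im (fm (cyl_base p)), snd (snd (T p)))) has_derivative T') (at p)"
    unfolding T'_def by (intro has_derivative_Pair bounded_linear.has_derivative[OF bounded_linear_Re fm]
        bounded_linear.has_derivative[OF bounded_linear_Im fm] \<Theta>)
  then have dT: "(T has_derivative T') (at p)"
    by (rule has_derivative_cong_open[OF open_cyl p, THEN iffD2, rotated])
      (use T in \<open>simp add: cyl_base_def complex_eq_iff prod_eq_iff\<close>)
  have dPsi: "(Psi phi has_derivative Psi_deriv phi p) (at p)"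
    by (rule Psi_has_derivative) (use holo_phi Im_phi w in \<open>simp_all add: w_def\<close>)
  have dPsi': "(Psi psi has_derivative Psi_deriv psi (T p)) (at (T p))"
    by (rule Psi_has_derivative) (use holo_psi Im_psi fm_in w in \<open>simp_all add: T[OF p] w_def\<close>)
  have "((\<lambda>p. f (Psi phi p)) has_derivative (\<lambda>u. Psi_deriv psi (T p) (T' u))) (at p)"
    by (rule has_derivative_cong_open[OF open_cyl p f, THEN iffD2])
      (assumption, rule has_derivative_compose[OF dT dPsi'])
  from fun_cong[OF has_derivative_unique[OF has_derivative_compose[OF dPsi D] this], of u]
  show ?thesis by (simp only: T'_def w_def)
qed

section \<open>Necessity: a contact lift forces the star condition\<close>

text \<open>The vertical derivative \<open>\<Theta>\<^sub>\<theta>\<close> is \<open>\<kappa>\<^sub>1 / \<kappa>\<^sub>0\<close>; it is an integer by periodicity in \<open>\<theta>\<close>,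
  and so is its inverse because \<open>f\<close> is injective.\<close>

lemma contact_lift_imp_star:
  assumes ct: "contact_transform a b a' b' phi psi \<Omega> \<Omega>' (\<lambda>p. (S p, X p, \<Theta> p))"
    and cov: "\<And>p. p \<in> cyl a b \<Longrightarrow> g (Pi_map (Psi phi p)) = Pi_map (Psi psi (S p, X p, \<Theta> p))"
  shows "p \<in> cyl a b \<Longrightarrow> cyl_base (S p, X p, \<Theta> p) = fm (cyl_base p)"
    and "star_condition a b a' phi psi \<phi>"
proof -
  define T where "T p = (S p, X p, \<Theta> p)" for p
  have "T ` cyl a b \<subseteq> cyl a' b'" and T: "C2_on T (cyl a b)"
    and "\<exists>f f_inv. homeomorphism (Pi_map -` \<Omega>) (Pi_map -` \<Omega>') f f_inv \<and>
        C2_on f (Pi_map -` \<Omega>) \<and> orientation_preserving_on heis_coord f (Pi_map -` \<Omega>) \<and>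
        contact_on f (Pi_map -` \<Omega>) \<and> (\<forall>p\<in>cyl a b. f (Psi phi p) = Psi psi (T p))"
    using ct[unfolded contact_transform_def, folded T_def]
    by (rule conjunct1, rule conjunct2[THEN conjunct1], rule conjunct2[THEN conjunct2])
  then obtain f f_inv where T_in: "\<And>p. p \<in> cyl a b \<Longrightarrow> T p \<in> cyl a' b'"
    and hom: "homeomorphism (Pi_map -` \<Omega>) (Pi_map -` \<Omega>') f f_inv"
    and f: "C2_on f (Pi_map -` \<Omega>)" "contact_on f (Pi_map -` \<Omega>)"
    and f_Psi: "\<And>p. p \<in> cyl a b \<Longrightarrow> f (Psi phi p) = Psi psi (T p)"
    by blast
  have inj: "inj_on f (Pi_map -` \<Omega>)"
    using hom by (metis homeomorphism_def inj_on_inverseI)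
  have wR: "cyl_base p \<in> R" if "p \<in> cyl a b" for p using that by (simp add: cyl_base_in_rect)
  have Psi_in: "Psi phi p \<in> Pi_map -` \<Omega>" if "p \<in> cyl a b" for p
    using Psi_image_cyl[OF phiD(3) domains(2)] that by blast
  \<comment> \<open>The covering relation gives equality after psi; injectivity of psi removes it
    and determines S and X.\<close>
  have base: "cyl_base (T p) = fm (cyl_base p)" if p: "p \<in> cyl a b" for p
  proof -
    have R': "cyl_base (T p) \<in> R'" using T_in[OF p] by (simp add: cyl_base_in_rect)
    have "psi (fm (cyl_base p)) = psi (cyl_base (T p))"
      using cov[OF p] Im_phi[OF wR[OF p]] Im_psi[OF R'] by (simp add: Pi_map_Psi g_phi[OF wR[OF p]] flip: T_def)
    then show ?thesis using psiD(2) R' fm_in[OF wR[OF p]] by (metis inj_onD)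
  qed
  then show "p \<in> cyl a b \<Longrightarrow> cyl_base (S p, X p, \<Theta> p) = fm (cyl_base p)" for p
    by (simp add: T_def)
  have "C2_on (\<lambda>p. snd (snd (T p))) (cyl a b)"
    by (intro C2_on_linear[OF bounded_linear_snd] T)
  then have "C2_on \<Theta> (cyl a b)" by (simp add: T_def)
  then obtain \<Theta>' \<Theta>'' where \<Theta>: "\<And>q. q \<in> cyl a b \<Longrightarrow> (\<Theta> has_derivative blinfun_apply (\<Theta>' q)) (at q)"
      "\<And>q. q \<in> cyl a b \<Longrightarrow> (\<Theta>' has_derivative blinfun_apply (\<Theta>'' q)) (at q)"
      "continuous_on (cyl a b) \<Theta>''"
    unfolding C2_on_def by blast
  obtain l where l: "\<And>q v. q \<in> Pi_map -` \<Omega> \<Longrightarrow>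
      contact_form (f q) (frechet_derivative f (at q) v) = complex_of_real (l q) * contact_form q v"
    using f(2) unfolding contact_on_def by blast
  have pullback: "Im (psi (fm w)) * (U\<^sub>1 w * Re (cyl_base u) + V\<^sub>1 w * Im (cyl_base u) + \<Theta>' p u)
      = l (Psi phi p) * (Im (phi w) * (U\<^sub>0 w * Re (cyl_base u) + V\<^sub>0 w * Im (cyl_base u) + snd (snd u)))"
    if p: "p \<in> cyl a b" and w_def: "w = cyl_base p" for p u w
  proof -
    define T' where "T' u = (Re (fm_deriv w (cyl_base u)), Im (fm_deriv w (cyl_base u)), \<Theta>' p u)" for u
    have \<Theta>p: "((\<lambda>q. snd (snd (T q))) has_derivative \<Theta>' p) (at p)"
      using \<Theta>(1)[OF p] by (simp add: T_def)
    have "frechet_derivative f (at (Psi phi p)) (Psi_deriv phi p u) = Psi_deriv psi (T p) (T' u)"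
      unfolding T'_def w_def
      by (rule lift_deriv[OF p base \<Theta>p C2_on_imp_frechet_derivative[OF f(1) Psi_in[OF p]] f_Psi])
    then have "contact_form (Psi psi (T p)) (Psi_deriv psi (T p) (T' u))
        = complex_of_real (l (Psi phi p)) * contact_form (Psi phi p) (Psi_deriv phi p u)"
      using l[OF Psi_in[OF p], of "Psi_deriv phi p u"] by (simp add: f_Psi[OF p])
    moreover have "cyl_base (T' u) = fm_deriv (cyl_base p) (cyl_base u)" "snd (snd (T' u)) = \<Theta>' p u"
      by (simp_all add: T'_def cyl_base_def complex_surj w_def)
    ultimately show ?thesis
      unfolding contact_form_source[OF p] contact_form_target[of p T T' u, OF p base[OF p] \<open>cyl_base (T' u) = _\<close>]
        of_real_mult[symmetric] of_real_eq_iff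
      by (simp add: w_def)
  qed
  \<comment> \<open>The vertical direction in \<open>pullback\<close> gives Im psi times
    \<Theta>_\<theta> = l times Im phi. This eliminates the unknown factor l from the s and x
    directions and yields the hypotheses of \<open>contact_lift_curl\<close>.\<close>
  have slope: "\<Theta>' p (0, 0, 1) = \<kappa>\<^sub>1 (cyl_base p) / \<kappa>\<^sub>0 (cyl_base p)" if p: "p \<in> cyl a b" for p
  proof -
    have w: "cyl_base p \<in> R" using wR[OF p] .
    have b: "cyl_base (1, 0, 0) = 1" "cyl_base (0, 1, 0) = \<i>" "cyl_base (0, 0, 1) = 0"
      by (simp_all add: cyl_base_def complex_eq_iff)
    note d = C1_forms[THEN C1_on_imp_has_derivative, OF w]
    have lift: "\<Theta>' q (1, 0, 0) = \<Theta>' q (0, 0, 1) * U\<^sub>0 (cyl_base q) - U\<^sub>1 (cyl_base q)"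
      "\<Theta>' q (0, 1, 0) = \<Theta>' q (0, 0, 1) * V\<^sub>0 (cyl_base q) - V\<^sub>1 (cyl_base q)" if q: "q \<in> cyl a b" for q
    proof -
      \<comment> \<open>Read I as Im psi, L as the contact factor, P as Im phi, M as
        \<Theta>_\<theta>, A as \<Theta>_s or \<Theta>_x, and K, N as the coefficients of the source
        and target forms.\<close>
      have cancel: "A = M * K - N" if "I * (N + A) = L * (P * K)" "I * M = L * P" "0 < I" for A M K N I L P :: real
      proof -
        have "I * (N + A) = I * (M * K)" using that(1,2) by algebra
        then show ?thesis using that(3) by simp
      qed
      have I: "0 < Im (psi (fm (cyl_base q)))" using Im_psi[OF fm_in[OF wR[OF q]]] .
      note pb = pullback[OF q refl, of "(0, 0, 1)"] pullback[OF q refl, of "(1, 0, 0)"]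
        pullback[OF q refl, of "(0, 1, 0)"]
      show "\<Theta>' q (1, 0, 0) = \<Theta>' q (0, 0, 1) * U\<^sub>0 (cyl_base q) - U\<^sub>1 (cyl_base q)"
        by (rule cancel[OF _ _ I]) (use pb in \<open>simp_all add: b\<close>)
      show "\<Theta>' q (0, 1, 0) = \<Theta>' q (0, 0, 1) * V\<^sub>0 (cyl_base q) - V\<^sub>1 (cyl_base q)"
        by (rule cancel[OF _ _ I]) (use pb in \<open>simp_all add: b\<close>)
    qed
    let ?D = "\<lambda>K. frechet_derivative K (at (cyl_base p)) :: complex \<Rightarrow> real"
    have "\<Theta>' p (0, 0, 1) * (?D V\<^sub>0 1 - ?D U\<^sub>0 \<i>) = ?D V\<^sub>1 1 - ?D U\<^sub>1 \<i>"
      by (rule contact_lift_curl[OF p \<Theta> lift d])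
    then show ?thesis
      using form\<^sub>0_curl[OF w d(1,2)] form\<^sub>1_curl[OF w d(3,4)] \<kappa>\<^sub>0_pos[OF w] by (simp add: field_simps)
  qed
  have "\<kappa>\<^sub>1 w = \<kappa>\<^sub>0 w" if w: "w \<in> R" for w
  proof -
    define m where "m = \<kappa>\<^sub>1 w / \<kappa>\<^sub>0 w"
    have m: "0 < m" using \<kappa>\<^sub>0_pos[OF w] \<kappa>\<^sub>1_pos[OF w] by (simp add: m_def)
    \<comment> \<open>The line covering the circle over w. The slope of \<Theta> depends on the base
      point only, so \<Theta> is affine along it.\<close>
    define P where "P t = (Re w, Im w, t)" for t :: real
    have Pb: "cyl_base (P t) = w" for t by (simp add: P_def cyl_base_def)
    have P: "P t \<in> cyl a b" for t using w Pb cyl_base_in_rect by metis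
    have "((\<lambda>t. \<Theta> (P t)) has_real_derivative m) (at t)" for t
    proof -
      have "(P has_derivative (\<lambda>d. d *\<^sub>R (0, 0, 1))) (at t)"
        unfolding P_def by (auto intro!: derivative_eq_intros)
      from has_derivative_compose[OF this \<Theta>(1)[OF P]]
      show ?thesis
        unfolding has_field_derivative_def blinfun.scaleR_right slope[OF P] Pb m_def[symmetric]
        by (simp add: mult.commute[of _ m])
    qed
    then have lin: "\<Theta> (P t) = \<Theta> (P 0) + t * m" for t
      using DERIV_const_ratio_const[of 0 t "\<lambda>t. \<Theta> (P t)" m] by (cases "t = 0") auto
    have Psi_phi: "Psi phi (P t) = (of_real (sqrt (Im (phi w))) * cis t, Re (phi w))" for t
      by (simp add: Psi_eq Pb) (simp add: P_def)
    have Psi_psi: "Psi psi (T (P t)) = (of_real (sqrt (Im (psi (fm w)))) * cis (\<Theta> (P 0) + t * m), Re (psi (fm w)))" for t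
      unfolding Psi_eq base[OF P] Pb by (simp add: T_def lin[of t])
    have "Psi phi (P (2 * pi)) = Psi phi (P 0)" by (simp add: Psi_phi)
    then have "Psi psi (T (P (2 * pi))) = Psi psi (T (P 0))" using f_Psi[OF P] by metis
    then have "cis (\<Theta> (P 0) + 2 * pi * m) = cis (\<Theta> (P 0))"
      using Im_psi[OF fm_in[OF w]] by (simp add: Psi_psi)
    then have 1: "m \<in> \<int>" by (rule cis_add_cancel)
    \<comment> \<open>Advancing the source angle by 2 pi / m advances the target angle by exactly 2
      pi, so f takes the same value at both points.\<close>
    have "Psi psi (T (P (2 * pi / m))) = Psi psi (T (P 0))"
      using m by (simp add: Psi_psi flip: cis_mult)
    then have "f (Psi phi (P (2 * pi / m))) = f (Psi phi (P 0))" using f_Psi[OF P] by metis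
    then have "Psi phi (P (2 * pi / m)) = Psi phi (P 0)" using inj Psi_in[OF P] by (meson inj_onD)
    then have "cis (0 + 2 * pi * (1 / m)) = cis 0"
      using Im_phi[OF w] by (simp add: Psi_phi)
    then have "1 / m \<in> \<int>" by (rule cis_add_cancel)
    from pos_Int_inverse_Int[OF 1 this m] show ?thesis using \<kappa>\<^sub>0_pos[OF w] by (simp add: m_def)
  qed
  then show "star_condition a b a' phi psi \<phi>" by (simp add: star_iff)
qed

section \<open>The equations for h as an exactness problem\<close>

lemma h_equations_iff:
  "h_equations a b a' phi psi \<phi> h \<longleftrightarrow> (\<forall>s\<in>{0<..<a}. \<forall>x\<in>{0<..<b}.
     ((\<lambda>\<xi>. h s \<xi>) has_real_derivative V\<^sub>0 (Complex s x) - V\<^sub>1 (Complex s x)) (at x) \<and>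
     ((\<lambda>\<sigma>. h \<sigma> x) has_real_derivative U\<^sub>0 (Complex s x) - U\<^sub>1 (Complex s x)) (at s))"
  unfolding h_equations_def
proof (intro ball_cong refl)
  fix s x assume "s \<in> {0<..<a}" "x \<in> {0<..<b}"
  then have w: "Complex s x \<in> R" by (simp add: rect_def)
  have fm: "fm (Complex s x) = Complex (a' / a * s) (\<phi> x)" by (simp add: f_map_def)
  have p: "partial_s phi s x = deriv phi (Complex s x)"
    by (rule partial_s_eq[OF holo_phi[OF w]])
  have q: "partial_s psi (a' / a * s) (\<phi> x) = deriv psi (Complex (a' / a * s) (\<phi> x))"
    by (rule partial_s_eq[OF holo_psi[OF fm_in[OF w], unfolded fm]])
  \<comment> \<open>Each equation determines \<open>hx\<close> or \<open>hs\<close>, so the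
    existential quantifiers collapse. The resulting values are those that contactness demands of
    \<Theta> = \<theta> + h, where \<Theta>_\<theta> = 1.\<close>
  have half: "t = - y / 2 - - c * z / 2 \<longleftrightarrow> 2 * t = z * c - y" for c t y z :: real
    by (simp add: field_simps)
  have half': "t = y / 2 - c * z / 2 \<longleftrightarrow> 2 * t = y - c * z" for c t y z :: real
    by (simp add: field_simps)
  have V: "hx = V\<^sub>0 (Complex s x) - V\<^sub>1 (Complex s x) \<longleftrightarrow> 2 * hx =
      Im (partial_s psi (a' / a * s) (\<phi> x)) / Im (psi (Complex (a' / a * s) (\<phi> x))) * deriv \<phi> x
      - Im (partial_s phi s x) / Im (phi (Complex s x))" for hx
    unfolding p q V\<^sub>0_def V\<^sub>1_def fm log_form_def Im_divide_of_real complex.sel by (rule half)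
  have U: "hs = U\<^sub>0 (Complex s x) - U\<^sub>1 (Complex s x) \<longleftrightarrow> 2 * hs =
      Re (partial_s phi s x) / Im (phi (Complex s x))
      - a' / a * (Re (partial_s psi (a' / a * s) (\<phi> x)) / Im (psi (Complex (a' / a * s) (\<phi> x))))" for hs
    unfolding p q U\<^sub>0_def U\<^sub>1_def fm log_form_def Re_divide_of_real k_def by (rule half')
  show "(\<exists>hs hx. ((\<lambda>\<xi>. h s \<xi>) has_real_derivative hx) (at x) \<and>
        ((\<lambda>\<sigma>. h \<sigma> x) has_real_derivative hs) (at s) \<and>
        2 * hx = Im (partial_s psi (a' / a * s) (\<phi> x)) / Im (psi (Complex (a' / a * s) (\<phi> x)))
                   * deriv \<phi> x
                 - Im (partial_s phi s x) / Im (phi (Complex s x)) \<and>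
        2 * hs = Re (partial_s phi s x) / Im (phi (Complex s x))
                 - a' / a * (Re (partial_s psi (a' / a * s) (\<phi> x))
                              / Im (psi (Complex (a' / a * s) (\<phi> x))))) \<longleftrightarrow>
     ((\<lambda>\<xi>. h s \<xi>) has_real_derivative V\<^sub>0 (Complex s x) - V\<^sub>1 (Complex s x)) (at x) \<and>
     ((\<lambda>\<sigma>. h \<sigma> x) has_real_derivative U\<^sub>0 (Complex s x) - U\<^sub>1 (Complex s x)) (at s)"
    unfolding U[symmetric] V[symmetric] by blast
qed

definition h_deriv :: "complex \<Rightarrow> complex \<Rightarrow>\<^sub>L real" where
  "h_deriv w = (U\<^sub>0 w - U\<^sub>1 w) *\<^sub>R Blinfun Re + (V\<^sub>0 w - V\<^sub>1 w) *\<^sub>R Blinfun Im"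

lemma h_deriv_apply:
  "blinfun_apply (h_deriv w) u = (U\<^sub>0 w - U\<^sub>1 w) * Re u + (V\<^sub>0 w - V\<^sub>1 w) * Im u"
  by (simp add: h_deriv_def blinfun.add_left blinfun.scaleR_left bounded_linear_Blinfun_apply
      bounded_linear_Re bounded_linear_Im)

lemma C1_h_deriv: "C1_on h_deriv R"
  unfolding h_deriv_def by (intro C1_on_add C1_on_scaleR C1_on_diff C1_on_const C1_forms)

text \<open>Closedness is symmetry of the derivative of \<open>h_deriv\<close>. By bilinearity this
  is one scalar identity, for the pair 1 and \<i>, and it says that the two curls agree; convexity
  of the rectangle does the rest.\<close>

lemma h_deriv_primitive:
  assumes star: "\<And>w. w \<in> R \<Longrightarrow> \<kappa>\<^sub>1 w = \<kappa>\<^sub>0 w"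
  obtains H where "\<And>w. w \<in> R \<Longrightarrow> (H has_derivative blinfun_apply (h_deriv w)) (at w)"
proof -
  obtain G' where G': "\<And>w. w \<in> R \<Longrightarrow> (h_deriv has_derivative blinfun_apply (G' w)) (at w)"
    "continuous_on R G'"
    using C1_h_deriv by (rule C1_onE) blast
  have "G' w u v = G' w v u" if w: "w \<in> R" for w u v
  proof -
    note d = C1_forms[THEN C1_on_imp_has_derivative, OF w]
    let ?D = "\<lambda>K. frechet_derivative K (at w) :: complex \<Rightarrow> real"
    have *: "G' w u v = (?D U\<^sub>0 u - ?D U\<^sub>1 u) * Re v + (?D V\<^sub>0 u - ?D V\<^sub>1 u) * Im v" for u v
    proof -
      have 1: "((\<lambda>w. h_deriv w v) has_derivative (\<lambda>u. G' w u v)) (at w)"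
        by (rule bounded_linear.has_derivative[OF blinfun.bounded_linear_left G'(1)[OF w]])
      have 2: "((\<lambda>w. h_deriv w v) has_derivative
          (\<lambda>u. (?D U\<^sub>0 u - ?D U\<^sub>1 u) * Re v + (?D V\<^sub>0 u - ?D V\<^sub>1 u) * Im v)) (at w)"
        unfolding h_deriv_apply
        by (intro has_derivative_add has_derivative_mult_left has_derivative_diff d)
      from fun_cong[OF has_derivative_unique[OF 1 2]] show ?thesis .
    qed
    have lin: "?D K u = Re u * ?D K 1 + Im u * ?D K \<i>" if "(K has_derivative ?D K) (at w)" for K u
    proof -
      interpret linear "?D K" using that by (rule has_derivative_linear)
      have "?D K u = ?D K (Re u *\<^sub>R 1 + Im u *\<^sub>R \<i>)"
        by (rule arg_cong[of _ _ "?D K"]) (simp add: complex_eq_iff)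
      then show ?thesis by (simp only: add scale real_scaleR_def)
    qed
    \<comment> \<open>The curl identity is solved for one partial derivative so that it can be
      substituted.\<close>
    have closed: "?D V\<^sub>0 1 = ?D V\<^sub>1 1 - ?D U\<^sub>1 \<i> + ?D U\<^sub>0 \<i>"
      using form\<^sub>0_curl[OF w d(1,2)] form\<^sub>1_curl[OF w d(3,4)] star[OF w] by simp
    then show ?thesis
      unfolding * lin[OF d(1), of u] lin[OF d(1), of v] lin[OF d(2), of u] lin[OF d(2), of v]
        lin[OF d(3), of u] lin[OF d(3), of v] lin[OF d(4), of u] lin[OF d(4), of v] closed
      by (simp add: algebra_simps)
  qed
  then obtain H where "\<And>w. w \<in> R \<Longrightarrow> (H has_derivative blinfun_apply (h_deriv w)) (at w)"
    using Poincare_convex[OF open_rect convex_rect G'] by blast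
  then show ?thesis by (rule that)
qed

lemma partials_of_primitive:
  assumes H: "\<And>w. w \<in> R \<Longrightarrow> (H has_derivative blinfun_apply (h_deriv w)) (at w)"
    and "s \<in> {0<..<a}" "x \<in> {0<..<b}"
  shows "((\<lambda>\<xi>. H (Complex s \<xi>)) has_real_derivative V\<^sub>0 (Complex s x) - V\<^sub>1 (Complex s x)) (at x)"
    and "((\<lambda>\<sigma>. H (Complex \<sigma> x)) has_real_derivative U\<^sub>0 (Complex s x) - U\<^sub>1 (Complex s x)) (at s)"
proof -
  have w: "Complex s x \<in> R" using assms(2,3) by (simp add: rect_def)
  have "(Complex s has_derivative Complex 0) (at x)"
    by (rule has_derivative_Complex[OF has_derivative_const has_derivative_ident])
  from has_derivative_compose[OF this H[OF w]]
  show "((\<lambda>\<xi>. H (Complex s \<xi>)) has_real_derivative V\<^sub>0 (Complex s x) - V\<^sub>1 (Complex s x)) (at x)"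
    by (simp add: has_field_derivative_def h_deriv_apply)
  have "((\<lambda>\<sigma>. Complex \<sigma> x) has_derivative (\<lambda>d. Complex d 0)) (at s)"
    by (rule has_derivative_Complex[OF has_derivative_ident has_derivative_const])
  from has_derivative_compose[OF this H[OF w]]
  show "((\<lambda>\<sigma>. H (Complex \<sigma> x)) has_real_derivative U\<^sub>0 (Complex s x) - U\<^sub>1 (Complex s x)) (at s)"
    by (simp add: has_field_derivative_def h_deriv_apply)
qed

lemma h_equations_exists:
  assumes "\<And>w. w \<in> R \<Longrightarrow> \<kappa>\<^sub>1 w = \<kappa>\<^sub>0 w"
  shows "\<exists>h. h_equations a b a' phi psi \<phi> h"
proof -
  obtain H where "\<And>w. w \<in> R \<Longrightarrow> (H has_derivative blinfun_apply (h_deriv w)) (at w)"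
    using h_deriv_primitive[OF assms] by blast
  from partials_of_primitive[OF this] have "h_equations a b a' phi psi \<phi> (\<lambda>s x. H (Complex s x))"
    unfolding h_equations_iff by blast
  then show ?thesis by blast
qed

text \<open>The equations supply only partial derivatives of h. The difference from a differentiable
  primitive H has vanishing partials, hence is constant on the rectangle, and h inherits the total
  derivative of H.\<close>

lemma h_equations_has_derivative:
  assumes star: "\<And>w. w \<in> R \<Longrightarrow> \<kappa>\<^sub>1 w = \<kappa>\<^sub>0 w"
    and h: "h_equations a b a' phi psi \<phi> h" and w: "w \<in> R"
  shows "((\<lambda>w. h (Re w) (Im w)) has_derivative blinfun_apply (h_deriv w)) (at w)"
proof -
  obtain H where H: "\<And>w. w \<in> R \<Longrightarrow> (H has_derivative blinfun_apply (h_deriv w)) (at w)"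
    using h_deriv_primitive[OF star] by blast
  define d where "d s x = h s x - H (Complex s x)" for s x
  have h': "((\<lambda>\<xi>. h s \<xi>) has_real_derivative V\<^sub>0 (Complex s x) - V\<^sub>1 (Complex s x)) (at x)"
     "((\<lambda>\<sigma>. h \<sigma> x) has_real_derivative U\<^sub>0 (Complex s x) - U\<^sub>1 (Complex s x)) (at s)"
    if "s \<in> {0<..<a}" "x \<in> {0<..<b}" for s x
    using h that unfolding h_equations_iff by blast+
  have dx: "d s x = d s y" if "s \<in> {0<..<a}" "x \<in> {0<..<b}" "y \<in> {0<..<b}" for s x y
  proof (rule DERIV_isconst3[OF pos(2) that(2,3)])
    fix z assume "z \<in> {0<..<b}"
    from DERIV_diff[OF h'(1)[OF that(1) this] partials_of_primitive(1)[OF H that(1) this]]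
    show "(d s has_real_derivative 0) (at z)" by (simp add: d_def[abs_def])
  qed
  have ds: "d s x = d t x" if "s \<in> {0<..<a}" "t \<in> {0<..<a}" "x \<in> {0<..<b}" for s t x
  proof (rule DERIV_isconst3[OF pos(1) that(1,2)])
    fix z assume "z \<in> {0<..<a}"
    from DERIV_diff[OF h'(2)[OF this that(3)] partials_of_primitive(2)[OF H this that(3)]]
    show "((\<lambda>s. d s x) has_real_derivative 0) (at z)" by (simp add: d_def[abs_def])
  qed
  have "h (Re z) (Im z) = H z + d (Re w) (Im w)" if z: "z \<in> R" for z
  proof -
    \<comment> \<open>A vertical and then a horizontal segment join z to w inside the
      rectangle.\<close>
    have "d (Re z) (Im z) = d (Re w) (Im w)"
      using dx[of "Re z" "Im z" "Im w"] ds[of "Re z" "Re w" "Im w"] z w by (auto simp: rect_def)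
    then show ?thesis by (simp add: d_def)
  qed
  moreover have "((\<lambda>z. H z + d (Re w) (Im w)) has_derivative blinfun_apply (h_deriv w)) (at w)"
    using has_derivative_add[OF H[OF w] has_derivative_const] by simp
  ultimately show ?thesis by (rule has_derivative_cong_open[OF open_rect w, THEN iffD2])
qed

section \<open>Sufficiency: construction of the contact lift\<close>

text \<open>The lift of \<open>g\<close> is \<open>(z, t) \<mapsto> (z * M w, Re (g w))\<close> with \<open>w = Pi_map (z, t)\<close>; the modulus of \<open>M\<close> is
  \<open>sqrt (Im (g w) / Im w)\<close>.\<close>

lemma star_imp_contact_transform:
  assumes star: "\<And>w. w \<in> R \<Longrightarrow> \<kappa>\<^sub>1 w = \<kappa>\<^sub>0 w" and h: "h_equations a b a' phi psi \<phi> h"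
  shows "contact_transform a b a' b' phi psi \<Omega> \<Omega>' (\<lambda>(s, x, \<theta>). (a' / a * s, \<phi> x, \<theta> + h s x))"
proof -
  define H where "H w = h (Re w) (Im w)" for w
  have dH: "(H has_derivative blinfun_apply (h_deriv w)) (at w)" if "w \<in> R" for w
    unfolding H_def[abs_def] by (rule h_equations_has_derivative[OF star h that])
  have C2H: "C2_on H R" by (rule C2_onI[OF dH C1_h_deriv])
  define T where "T p = (k * fst p, \<phi> (fst (snd p)), snd (snd p) + H (cyl_base p))" for p
  have T_eq: "T = (\<lambda>(s, x, \<theta>). (a' / a * s, \<phi> x, \<theta> + h s x))"
    by (auto simp: T_def fun_eq_iff k_def H_def cyl_base_def)
  have base: "cyl_base (T p) = fm (cyl_base p)" for p
    by (simp add: T_def cyl_base_def fm_eq)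
  have wR: "cyl_base p \<in> R" if "p \<in> cyl a b" for p using that by (simp add: cyl_base_in_rect)
  have T_in: "T p \<in> cyl a' b'" if "p \<in> cyl a b" for p
    using fm_in[OF wR[OF that]] unfolding base[symmetric] by (simp add: cyl_base_in_rect)
  have T_onto: "\<exists>p\<in>cyl a b. T p = q" if q: "q \<in> cyl a' b'" for q
  proof -
    have "cyl_base q \<in> R'" using q by (simp add: cyl_base_in_rect)
    then obtain w where w: "w \<in> R" "fm w = cyl_base q" by (rule fm_onto)
    \<comment> \<open>Subtracting H undoes the shift of the angle by T.\<close>
    define p where "p = (Re w, Im w, snd (snd q) - H w)"
    have pw: "cyl_base p = w" by (simp add: p_def cyl_base_def)
    have "snd (snd (T p)) = snd (snd q)" unfolding T_def pw by (simp add: p_def)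
    moreover have "cyl_base (T p) = cyl_base q" by (simp add: base pw w)
    ultimately have "T p = q" by (simp add: cyl_base_def prod_eq_iff)
    moreover have "p \<in> cyl a b" using w(1) pw cyl_base_in_rect by metis
    ultimately show ?thesis by blast
  qed
  have C2T: "C2_on T (cyl a b)"
    unfolding T_def[abs_def]
  proof (intro C2_on_Pair C2_on_add)
    show "C2_on (\<lambda>p. k * fst p) (cyl a b)"
      by (intro C2_on_mult C2_on_const C2_on_bounded_linear bounded_linear_fst)
    show "C2_on (\<lambda>p. \<phi> (fst (snd p))) (cyl a b)"
      by (rule C2_on_compose[OF C2_varphi])
        (auto simp: cyl_def intro!: C2_on_bounded_linear bounded_linear_compose[OF bounded_linear_fst] bounded_linear_snd)
    show "C2_on (\<lambda>p. snd (snd p)) (cyl a b)"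
      by (intro C2_on_linear[OF bounded_linear_snd] C2_on_bounded_linear bounded_linear_snd)
    show "C2_on (\<lambda>p. H (cyl_base p)) (cyl a b)"
      by (rule C2_on_compose[OF C2H C2_on_bounded_linear[OF bounded_linear_cyl_base]]) (use wR in auto)
  qed
  define S where "S = Pi_map -` \<Omega>"
  define S' where "S' = Pi_map -` \<Omega>'"
  have S_eq: "Psi phi ` cyl a b = S" unfolding S_def by (rule Psi_image_cyl[OF phiD(3) domains(2)])
  have S'_eq: "Psi psi ` cyl a' b' = S'" unfolding S'_def by (rule Psi_image_cyl[OF psiD(3) domains(4)])
  have Pi_phi: "Pi_map (Psi phi p) = phi (cyl_base p)" if "p \<in> cyl a b" for p
    using Im_phi[OF wR[OF that]] by (simp add: Pi_map_Psi)
  have Pi_psi: "Pi_map (Psi psi (T p)) = psi (fm (cyl_base p))" if "p \<in> cyl a b" for p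
    using Im_psi[OF fm_in[OF wR[OF that]]] by (simp add: Pi_map_Psi base)
  \<comment> \<open>The argument of M is H at the rectangle point over w, so multiplication by M
    advances the angle by h. It depends on w alone, which makes f well defined on each
    circle.\<close>
  define M where "M w = exp (of_real ((ln (Im (g w)) - ln (Im w)) * (1 / 2)) + \<i> * of_real (H (inv_into R phi w)))" for w
  define f where "f p = (fst p * M (Pi_map p), Re (g (Pi_map p)))" for p
  have C2M: "C2_on M \<Omega>"
    unfolding M_def[abs_def]
  proof (rule C2_on_compose[OF C2_on_exp])
    have "C2_on (\<lambda>w. ln (Im (g w))) \<Omega>"
      by (rule C2_on_compose[OF C2_on_ln C2_on_linear[OF bounded_linear_Im g_regular]])
        (use g_in domains(4) in \<open>auto simp: upper_half_plane_def\<close>)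
    moreover have "C2_on (\<lambda>w. ln (Im w)) \<Omega>"
      by (rule C2_on_compose[OF C2_on_ln C2_on_bounded_linear[OF bounded_linear_Im]])
        (use domains(2) in \<open>auto simp: upper_half_plane_def\<close>)
    moreover have "C2_on (\<lambda>w. H (inv_into R phi w)) \<Omega>"
      by (rule C2_on_compose[OF C2H C2_on_holomorphic[OF phiD(4) domains(1)]]) (use phiD(7) in auto)
    ultimately show "C2_on (\<lambda>w. of_real ((ln (Im (g w)) - ln (Im w)) * (1 / 2)) + \<i> * of_real (H (inv_into R phi w))) \<Omega>"
      by (intro C2_on_add C2_on_diff C2_on_mult C2_on_const C2_on_linear[OF bounded_linear_of_real])
  qed auto
  have C2f: "C2_on f S"
    unfolding f_def[abs_def]
  proof (intro C2_on_Pair C2_on_mult)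
    show "C2_on (\<lambda>p. M (Pi_map p)) S"
      by (rule C2_on_compose[OF C2M C2_on_Pi_map]) (auto simp: S_def)
    show "C2_on (\<lambda>p. Re (g (Pi_map p))) S"
      by (rule C2_on_linear[OF bounded_linear_Re C2_on_compose[OF g_regular C2_on_Pi_map]]) (auto simp: S_def)
  qed (intro C2_on_bounded_linear bounded_linear_fst)
  have f_Psi: "f (Psi phi p) = Psi psi (T p)" if p: "p \<in> cyl a b" for p
  proof -
    define w where "w = cyl_base p"
    have w: "w \<in> R" using wR[OF p] by (simp add: w_def)
    have "M (phi w) = of_real (exp ((ln (Im (psi (fm w))) - ln (Im (phi w))) * (1 / 2))) * cis (H w)"
      by (simp add: M_def g_phi[OF w] phiD(6)[OF w] exp_add cis_conv_exp exp_of_real[symmetric])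
    then have "of_real (sqrt (Im (phi w))) * M (phi w) = of_real (sqrt (Im (psi (fm w)))) * cis (H w)"
      unfolding sqrt_mult_exp_half_ln[OF Im_phi[OF w] Im_psi[OF fm_in[OF w]], symmetric] by simp
    then have "of_real (sqrt (Im (phi w))) * cis (snd (snd p)) * M (phi w)
        = of_real (sqrt (Im (psi (fm w)))) * cis (snd (snd p) + H w)"
      by (simp add: cis_mult[symmetric] mult.assoc mult.left_commute)
    then have "fst (Psi phi p) * M (phi w) = fst (Psi psi (T p))"
      unfolding Psi_eq base w_def[symmetric] by (simp add: T_def w_def)
    then show ?thesis
      unfolding f_def Pi_phi[OF p] by (simp add: prod_eq_iff g_phi[OF w] Psi_eq base flip: w_def)
  qed
  have Pi_f: "Pi_map (f q) = g (Pi_map q)" if q: "q \<in> S" for q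
  proof -
    obtain p where p: "p \<in> cyl a b" "q = Psi phi p" using q S_eq by blast
    show ?thesis by (simp add: p(2) f_Psi[OF p(1)] Pi_phi[OF p(1)] Pi_psi[OF p(1)] g_phi[OF wR[OF p(1)]])
  qed
  have inj: "inj_on f S"
  proof (rule inj_onI)
    fix p q assume S: "p \<in> S" "q \<in> S" and eq: "f p = f q"
    have "Pi_map p = Pi_map q"
      using g_inj[of "Pi_map p" "Pi_map q"] S Pi_f[OF S(1)] Pi_f[OF S(2)] eq by (simp add: S_def)
    \<comment> \<open>M is an exponential, hence nonzero, and takes the same value at both
      points.\<close>
    moreover from this eq have "fst p = fst q" by (simp add: f_def M_def)
    ultimately show "p = q" by (simp add: Pi_map_def prod_eq_iff)
  qed
  have "f ` S = S'"
  proof -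
    have "T ` cyl a b = cyl a' b'" using T_in T_onto by blast
    then have "Psi psi ` T ` cyl a b = S'" by (simp add: S'_eq)
    moreover have "f ` S = Psi psi ` T ` cyl a b"
      unfolding S_eq[symmetric] image_image using f_Psi by (intro image_cong) auto
    ultimately show ?thesis by simp
  qed
  moreover have "open S"
    unfolding S_def by (rule open_vimage[OF domains(1) C1_on_imp_continuous_on[OF C2_on_imp_C1_on[OF C2_on_Pi_map]]])
  moreover have "continuous_on S f" by (rule C1_on_imp_continuous_on[OF C2_on_imp_C1_on[OF C2f]])
  \<comment> \<open>Source and target have equal dimension, so invariance of domain makes the
    inverse continuous.\<close>
  ultimately obtain f_inv where hom: "homeomorphism S S' f f_inv"
    using invariance_of_domain_homeomorphism[of S f] inj by auto
  define D where "D q = frechet_derivative f (at q)" for q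
  define T' where "T' p u = (Re (fm_deriv (cyl_base p) (cyl_base u)), Im (fm_deriv (cyl_base p) (cyl_base u)),
      snd (snd u) + h_deriv (cyl_base p) (cyl_base u))" for p u
  have dD: "(f has_derivative D q) (at q)" if "q \<in> S" for q
    unfolding D_def by (rule C2_on_imp_frechet_derivative[OF C2f that])
  have Psi_S: "Psi phi p \<in> S" if "p \<in> cyl a b" for p using S_eq that by blast
  have D_Psi: "D (Psi phi p) (Psi_deriv phi p u) = Psi_deriv psi (T p) (T' p u)" if p: "p \<in> cyl a b" for p u
    unfolding T'_def
  proof (rule lift_deriv[OF p base _ dD[OF Psi_S[OF p]] f_Psi])
    have "((\<lambda>q. H (cyl_base q)) has_derivative (\<lambda>u. h_deriv (cyl_base p) (cyl_base u))) (at p)"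
      by (rule has_derivative_compose[OF bounded_linear_imp_has_derivative[OF bounded_linear_cyl_base] dH[OF wR[OF p]]])
    moreover have "((\<lambda>q :: real \<times> real \<times> real. snd (snd q)) has_derivative (\<lambda>u. snd (snd u))) (at p)"
      by (intro has_derivative_snd has_derivative_ident)
    ultimately show "((\<lambda>q. snd (snd (T q))) has_derivative
        (\<lambda>u. snd (snd u) + h_deriv (cyl_base p) (cyl_base u))) (at p)"
      by (simp add: T_def has_derivative_add)
  qed
  have contact: "contact_on f S"
    unfolding contact_on_def
  \<comment> \<open>Since \<Theta>_\<theta> = 1, the normalised forms correspond exactly, and the
    contact factor is the quotient of the normalisations 2 Im psi and 2 Im phi.\<close>
  proof (intro exI[of _ "\<lambda>q. Im (g (Pi_map q)) / Im (Pi_map q)"] ballI conjI allI)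
    fix q v assume "q \<in> S"
    then obtain p where p: "p \<in> cyl a b" "q = Psi phi p" using S_eq by blast
    define w where "w = cyl_base p"
    have w: "w \<in> R" using wR[OF p(1)] by (simp add: w_def)
    have l: "Im (g (Pi_map q)) / Im (Pi_map q) = Im (psi (fm w)) / Im (phi w)"
      by (simp add: p(2) Pi_phi[OF p(1)] g_phi[OF w] flip: w_def)
    show "Im (g (Pi_map q)) / Im (Pi_map q) \<noteq> 0"
      unfolding l using Im_phi[OF w] Im_psi[OF fm_in[OF w]] by simp
    obtain u where u: "Psi_deriv phi p u = v"
      using Psi_deriv_surj[of phi p v] Im_phi[OF w] phiD(9)[OF w] by (auto simp: w_def)
    have T': "cyl_base (T' p u) = fm_deriv (cyl_base p) (cyl_base u)"
      "snd (snd (T' p u)) = snd (snd u) + ((U\<^sub>0 w - U\<^sub>1 w) * Re (cyl_base u) + (V\<^sub>0 w - V\<^sub>1 w) * Im (cyl_base u))"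
      by (simp_all add: T'_def cyl_base_def complex_surj w_def h_deriv_apply)
    have "contact_form (f q) (D q v) = complex_of_real (2 * Im (psi (fm w)) *
        (U\<^sub>0 w * Re (cyl_base u) + V\<^sub>0 w * Im (cyl_base u) + snd (snd u)))"
      unfolding p(2) u[symmetric] D_Psi[OF p(1)] f_Psi[OF p(1)]
        contact_form_target[of p T "T' p" u, OF p(1) base T'(1)] w_def[symmetric] T'(2)
      by (simp add: algebra_simps)
    also have "\<dots> = complex_of_real (Im (psi (fm w)) / Im (phi w)) * contact_form q v"
      unfolding p(2) u[symmetric] contact_form_source[OF p(1)] w_def[symmetric]
      using Im_phi[OF w] by simp
    finally show "contact_form (f q) (frechet_derivative f (at q) v)
        = complex_of_real (Im (g (Pi_map q)) / Im (Pi_map q)) * contact_form q v"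
      by (simp add: D_def l)
  qed
  have orient: "orientation_preserving_on heis_coord f S"
    unfolding orientation_preserving_on_def
  proof
    fix q assume q: "q \<in> S"
    then obtain p where p: "p \<in> cyl a b" "q = Psi phi p" using S_eq by blast
    define w where "w = cyl_base p"
    have w: "w \<in> R" using wR[OF p(1)] by (simp add: w_def)
    let ?v = "\<lambda>u. Psi_deriv phi p u"
    \<comment> \<open>No mixed planar terms occur, so \<open>heis_vol_Psi_deriv\<close> applies with
      k and \<phi>' as scale factors, whatever the angular entries.\<close>
    have T': "T' p (1, 0, 0) = (k, 0, h_deriv w 1)" "T' p (0, 1, 0) = (0, deriv \<phi> (Im w), h_deriv w \<i>)"
      "T' p (0, 0, 1) = (0, 0, 1)"
      by (auto simp: T'_def w_def fm_deriv_def cyl_base_def h_deriv_apply)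
    have src: "heis_vol (?v (1, 0, 0)) (?v (0, 1, 0)) (?v (0, 0, 1)) = (cmod (deriv phi w))\<^sup>2 / 2"
      using heis_vol_Psi_deriv[of phi p 1 0 1 0] Im_phi[OF w] by (simp add: w_def)
    have "heis_vol (D q (?v (1, 0, 0))) (D q (?v (0, 1, 0))) (D q (?v (0, 0, 1)))
        = k * deriv \<phi> (Im w) * (cmod (deriv psi (fm w)))\<^sup>2 / 2"
      unfolding p(2) D_Psi[OF p(1)] T'
      using heis_vol_Psi_deriv[of psi "T p"] Im_psi[OF fm_in[OF w]] by (simp add: w_def base)
    also have "\<dots> > 0"
      using k_pos deriv_varphi_pos[OF Im_R[OF w]] psiD(9)[OF fm_in[OF w]] by simp
    finally have "0 < det (matrix (heis_coord \<circ> D q \<circ> inv heis_coord)) * ((cmod (deriv phi w))\<^sup>2 / 2)"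
      unfolding heis_vol_linear[OF has_derivative_linear[OF dD[OF q]]] src .
    then show "0 < det (matrix (heis_coord \<circ> frechet_derivative f (at q) \<circ> inv heis_coord))"
      using phiD(9)[OF w] by (simp add: D_def zero_less_mult_iff)
  qed
  show ?thesis
    unfolding contact_transform_def T_eq[symmetric]
    using T_in C2T hom C2f orient contact f_Psi unfolding S_def S'_def by blast
qed

end

theorem proposition3p1p2:
  fixes a b a' b' :: real
    and phi psi :: "complex \<Rightarrow> complex"
    and \<Omega> \<Omega>' :: "complex set"
    and \<phi> :: "real \<Rightarrow> real"
  assumes pos: "0 < a" "0 < b" "0 < a'" "0 < b'"
    and domains: "open \<Omega>" "connected \<Omega>" "\<Omega> \<subseteq> upper_half_plane"
                 "open \<Omega>'" "connected \<Omega>'" "\<Omega>' \<subseteq> upper_half_plane"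
    and phi: "biholomorphic_onto phi (rect a b) \<Omega>"
             "extends_homeomorphically phi (rect a b) \<Omega>"
    and psi: "biholomorphic_onto psi (rect a' b') \<Omega>'"
             "extends_homeomorphically psi (rect a' b') \<Omega>'"
    and varphi: "\<phi> ` {0..b} \<subseteq> {0..b'}" "\<phi> 0 = 0" "\<phi> b = b'"
                "continuous_on {0..b} \<phi>" "\<phi> differentiable_on {0<..<b}"
                "\<And>x. x \<in> {0<..<b} \<Longrightarrow> a' / a \<le> deriv \<phi> x"
    and g_regular: "C2_on (g_map a b a' phi psi \<phi>) \<Omega>"
                   "orientation_preserving_on plane_coord (g_map a b a' phi psi \<phi>) \<Omega>"
  shows "(\<forall>S X \<Theta> :: real \<times> real \<times> real \<Rightarrow> real.
            contact_transform a b a' b' phi psi \<Omega> \<Omega>' (\<lambda>p. (S p, X p, \<Theta> p)) \<longrightarrow>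
            (\<forall>p\<in>cyl a b. g_map a b a' phi psi \<phi> (Pi_map (Psi phi p))
                           = Pi_map (Psi psi (S p, X p, \<Theta> p))) \<longrightarrow>
            (\<forall>s\<in>{0<..<a}. \<forall>x\<in>{0<..<b}. \<forall>\<theta>. S (s, x, \<theta>) = a' / a * s \<and> X (s, x, \<theta>) = \<phi> x) \<and>
            star_condition a b a' phi psi \<phi>) \<and>
         (star_condition a b a' phi psi \<phi> \<longrightarrow>
            (\<exists>h. h_equations a b a' phi psi \<phi> h) \<and>
            (\<forall>h. h_equations a b a' phi psi \<phi> h \<longrightarrow>
               contact_transform a b a' b' phi psi \<Omega> \<Omega>'
                 (\<lambda>(s, x, \<theta>). (a' / a * s, \<phi> x, \<theta> + h s x)) \<and>
               (\<forall>(s, x, \<theta>)\<in>cyl a b. g_map a b a' phi psi \<phi> (Pi_map (Psi phi (s, x, \<theta>)))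
                 = Pi_map (Psi psi (a' / a * s, \<phi> x, \<theta> + h s x)))))"
proof -
  interpret stretch a b a' b' phi psi \<Omega> \<Omega>' \<phi>
    by (unfold_locales; fact pos domains phi psi varphi g_regular)
  have lift: "(\<forall>s\<in>{0<..<a}. \<forall>x\<in>{0<..<b}. \<forall>\<theta>. S (s, x, \<theta>) = a' / a * s \<and> X (s, x, \<theta>) = \<phi> x) \<and>
      star_condition a b a' phi psi \<phi>"
    if ct: "contact_transform a b a' b' phi psi \<Omega> \<Omega>' (\<lambda>p. (S p, X p, \<Theta> p))"
      and cov: "\<forall>p\<in>cyl a b. g_map a b a' phi psi \<phi> (Pi_map (Psi phi p)) = Pi_map (Psi psi (S p, X p, \<Theta> p))"
    for S X \<Theta> :: "real \<times> real \<times> real \<Rightarrow> real"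
  proof (intro conjI ballI allI)
    show "star_condition a b a' phi psi \<phi>" by (rule contact_lift_imp_star(2)[OF ct]) (use cov in blast)
    fix s x \<theta> assume "s \<in> {0<..<a}" "x \<in> {0<..<b}"
    then have "(s, x, \<theta>) \<in> cyl a b" by (simp add: cyl_def)
    with contact_lift_imp_star(1)[OF ct] cov
    have "cyl_base (S (s, x, \<theta>), X (s, x, \<theta>), \<Theta> (s, x, \<theta>)) = fm (cyl_base (s, x, \<theta>))" by blast
    then show "S (s, x, \<theta>) = a' / a * s" "X (s, x, \<theta>) = \<phi> x"
      by (simp_all add: cyl_base_def f_map_def)
  qed
  \<comment> \<open>The target angle t is arbitrary because \<open>Pi_map\<close> forgets it; one
    statement thus serves every h.\<close>
  have cover: "g_map a b a' phi psi \<phi> (Pi_map (Psi phi (s, x, \<theta>))) = Pi_map (Psi psi (a' / a * s, \<phi> x, t))"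
    if "(s, x, \<theta>) \<in> cyl a b" for s x \<theta> t
  proof -
    have w: "Complex s x \<in> R" using that cyl_base_in_rect[of "(s, x, \<theta>)"] by (simp add: cyl_base_def)
    have fm: "fm (Complex s x) = Complex (a' / a * s) (\<phi> x)" by (simp add: f_map_def)
    have "Pi_map (Psi phi (s, x, \<theta>)) = phi (Complex s x)"
      using Pi_map_Psi[of phi "(s, x, \<theta>)"] Im_phi[OF w] by (simp add: cyl_base_def)
    moreover have "Pi_map (Psi psi (a' / a * s, \<phi> x, t)) = psi (Complex (a' / a * s) (\<phi> x))"
      using Pi_map_Psi[of psi "(a' / a * s, \<phi> x, t)"] Im_psi[OF fm_in[OF w]] fm by (simp add: cyl_base_def)
    ultimately show ?thesis using g_phi[OF w] fm by simp
  qed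
  have "(\<exists>h. h_equations a b a' phi psi \<phi> h) \<and>
      (\<forall>h. h_equations a b a' phi psi \<phi> h \<longrightarrow>
        contact_transform a b a' b' phi psi \<Omega> \<Omega>' (\<lambda>(s, x, \<theta>). (a' / a * s, \<phi> x, \<theta> + h s x)) \<and>
        (\<forall>(s, x, \<theta>)\<in>cyl a b. g_map a b a' phi psi \<phi> (Pi_map (Psi phi (s, x, \<theta>)))
          = Pi_map (Psi psi (a' / a * s, \<phi> x, \<theta> + h s x))))"
    if "star_condition a b a' phi psi \<phi>"
  proof -
    have star: "\<kappa>\<^sub>1 w = \<kappa>\<^sub>0 w" if "w \<in> R" for w
      using \<open>star_condition a b a' phi psi \<phi>\<close> that unfolding star_iff by blast
    show ?thesis
      using h_equations_exists[OF star] star_imp_contact_transform[OF star] cover by blast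
  qed
  with lift show ?thesis by blast
qed

end
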